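(* Let $(W,S)$ be a chordal Coxeter system of finite rank, and let $S'$ be another set of Coxeter generators for $W$. Then $(W,S')$ is chordal.
   Context: A Coxeter system $(W,S)$: $W=\langle S\mid (st)^{m(s,t)}\ (m(s,t)<\infty)\rangle$ with $m(s,s)=1$, $m(s,t)=m(t,s)\in\{2,3,\dots,\infty\}$ for $s\ne t$; $S$ is a set of Coxeter generators. The P-diagram $\Gamma(W,S)$ is the labeled graph with vertex set $S$ and an edge $\{s,t\}$ labeled $m(s,t)$ whenever $s\neq t$ and $m(s,t)<\infty$. $(W,S)$ is chordal if every cycle of length at least four in the underlying graph of $\Gamma(W,S)$ has a chord. *)

theory Defs
  imports "HOL-Algebra.Group" "HOL-Library.Extended_Nat"
begin

definition coxeter_matrix :: "'a set \<Rightarrow> ('a \<Rightarrow> 'a \<Rightarrow> enat) \<Rightarrow> bool" where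
  "coxeter_matrix S m \<longleftrightarrow>
     (\<forall>s\<in>S. m s s = 1) \<and>
     (\<forall>s\<in>S. \<forall>t\<in>S. m s t = m t s) \<and>
     (\<forall>s\<in>S. \<forall>t\<in>S. s \<noteq> t \<longrightarrow> 2 \<le> m s t)"

definition coxeter_relators :: "'a set \<Rightarrow> ('a \<Rightarrow> 'a \<Rightarrow> enat) \<Rightarrow> 'a list set" where
  "coxeter_relators S m =
     {concat (replicate k [s, t]) | s t k. s \<in> S \<and> t \<in> S \<and> m s t = enat k}"

definition relator_step :: "'a list set \<Rightarrow> ('a list \<times> 'a list) set" where
  "relator_step R = {(u @ r @ v, u @ v) | u r v. r \<in> R}"

text \<open>Equality of words in the group presented by the relators (congruence generated by r = 1).\<close>
definition presentation_equiv :: "'a list set \<Rightarrow> ('a list \<times> 'a list) set" where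
  "presentation_equiv R = (relator_step R \<union> (relator_step R)\<inverse>)\<^sup>*"

definition word_eval :: "('a, 'b) monoid_scheme \<Rightarrow> 'a list \<Rightarrow> 'a" where
  "word_eval G w = foldr (\<lambda>x y. x \<otimes>\<^bsub>G\<^esub> y) w \<one>\<^bsub>G\<^esub>"

text \<open>(G,S) is a Coxeter system with Coxeter matrix m: S generates G and the canonical
  map from the presented group <S | (st)^{m(s,t)}> to G is an isomorphism, i.e. a word over S
  is trivial in G iff it is trivial in the presented group.\<close>
definition coxeter_system :: "('a, 'b) monoid_scheme \<Rightarrow> 'a set \<Rightarrow> ('a \<Rightarrow> 'a \<Rightarrow> enat) \<Rightarrow> bool" where
  "coxeter_system G S m \<longleftrightarrow>
     group G \<and> S \<subseteq> carrier G \<and> coxeter_matrix S m \<and>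
     (\<forall>g\<in>carrier G. \<exists>w\<in>lists S. word_eval G w = g) \<and>
     (\<forall>w\<in>lists S. word_eval G w = \<one>\<^bsub>G\<^esub> \<longleftrightarrow>
        (w, []) \<in> presentation_equiv (coxeter_relators S m))"

definition pdiagram_edge :: "'a set \<Rightarrow> ('a \<Rightarrow> 'a \<Rightarrow> enat) \<Rightarrow> 'a \<Rightarrow> 'a \<Rightarrow> bool" where
  "pdiagram_edge S m s t \<longleftrightarrow> s \<in> S \<and> t \<in> S \<and> s \<noteq> t \<and> m s t \<noteq> \<infinity>"

definition graph_cycle :: "('a \<Rightarrow> 'a \<Rightarrow> bool) \<Rightarrow> 'a list \<Rightarrow> bool" where
  "graph_cycle E vs \<longleftrightarrow> distinct vs \<and> 3 \<le> length vs \<and>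
     (\<forall>i < length vs. E (vs ! i) (vs ! ((i + 1) mod length vs)))"

definition has_chord :: "('a \<Rightarrow> 'a \<Rightarrow> bool) \<Rightarrow> 'a list \<Rightarrow> bool" where
  "has_chord E vs \<longleftrightarrow> (\<exists>i j. i < length vs \<and> j < length vs \<and> i \<noteq> j \<and>
     j \<noteq> (i + 1) mod length vs \<and> i \<noteq> (j + 1) mod length vs \<and> E (vs ! i) (vs ! j))"

definition chordal_graph :: "'a set \<Rightarrow> ('a \<Rightarrow> 'a \<Rightarrow> bool) \<Rightarrow> bool" where
  "chordal_graph V E \<longleftrightarrow> (\<forall>vs. set vs \<subseteq> V \<and> graph_cycle E vs \<and> 4 \<le> length vs \<longrightarrow> has_chord E vs)"

definition chordal_coxeter :: "'a set \<Rightarrow> ('a \<Rightarrow> 'a \<Rightarrow> enat) \<Rightarrow> bool" where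
  "chordal_coxeter S m \<longleftrightarrow> chordal_graph S (pdiagram_edge S m)"

end

theory Submission
  imports Defs "HOL-Algebra.Coset"
begin

text \<open>
  A chordal graph that is not complete has a clique separator, so \<open>W\<close> splits as an amalgam of
  proper visual subgroups over a visual subgroup on a clique, and it acts on the Bass-Serre tree.
  Consecutive vertices of a chordless cycle of \<open>S'\<close> are involutions generating a finite group, so
  their fixed subtrees form a cycle of pairwise consecutively intersecting subtrees: either all of
  them share a vertex, and one continues in a smaller visual subgroup, or two non-adjacent ones
  share an edge. Hence two non-adjacent vertices \<open>a\<close>, \<open>b\<close> of the cycle lie in a common conjugate of
  the subgroup generated by some clique \<open>D\<close> of \<open>S\<close>. Now split \<open>W\<close> over \<open>S' - {a, b}\<close>. By the Helly
  property of subtrees the group generated by \<open>D\<close> fixes a vertex of the resulting tree, so \<open>a\<close> and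
  \<open>b\<close> have a common fixed vertex; but their fixed subtrees lie on different sides of the base edge.
\<close>

section \<open>Trees and their involutions\<close>

text \<open>Non-adjacency in the diagram means that \<open>m\<close> is infinite, so no relator
  joins letters from the two sides of a clique separator; this is what makes \<open>W\<close> split.
  A clique may generate an infinite group, since only its pairs are known to generate finite ones.
  Hence fixed-point theorems for finite groups do not apply, and Helly's property is used on fixed
  trees that meet in pairs.

  Two facts about words are required: visual subgroups intersect in visual subgroups, and a visual
  subgroup contains no generators beyond its own. They, and also the half-trees of the Bass-Serre
  trees, come from one source: a Z/2-valued cochain on the Cayley graph with even sum along every
  relator integrates to a function on \<open>W\<close>. In one case the cochain marks the edges that
  belong to a given reflection, in the other the edges labelled in one factor along which the
  amalgamated subgroup is entered or left.\<close>

text \<open>A tree is encoded as a connected graph all of whose edges are bridges; \<open>half_tree V adj p q H\<close>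
  says that \<open>H\<close> is the part containing \<open>p\<close> after the edge between \<open>p\<close> and \<open>q\<close> is removed.\<close>

definition half_tree :: "'v set \<Rightarrow> ('v \<Rightarrow> 'v \<Rightarrow> bool) \<Rightarrow> 'v \<Rightarrow> 'v \<Rightarrow> 'v set \<Rightarrow> bool" where
  "half_tree V adj p q H \<longleftrightarrow> adj p q \<and> H \<subseteq> V \<and> p \<in> H \<and> q \<in> V - H \<and>
     (\<forall>u v. adj u v \<longrightarrow> u \<in> H \<longrightarrow> v \<notin> H \<longrightarrow> u = p \<and> v = q)"

locale tree =
  fixes V :: "'v set" and adj :: "'v \<Rightarrow> 'v \<Rightarrow> bool"
  assumes adj_in: "adj u v \<Longrightarrow> u \<in> V \<and> v \<in> V"
    and adj_sym: "adj u v \<Longrightarrow> adj v u"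
    and conn: "u \<in> V \<Longrightarrow> v \<in> V \<Longrightarrow> adj\<^sup>*\<^sup>* u v"
    and bridge: "adj p q \<Longrightarrow> \<exists>H. half_tree V adj p q H"
begin

abbreviation half where "half \<equiv> half_tree V adj"

text \<open>Subtrees, described by the edges that they straddle instead of by paths. The empty set
  is convex, so nonemptiness has to be supplied separately where it matters.\<close>

definition convex :: "'v set \<Rightarrow> bool" where
  "convex T \<longleftrightarrow> T \<subseteq> V \<and> (\<forall>p q H. half p q H \<longrightarrow> T \<inter> H \<noteq> {} \<longrightarrow> \<not> T \<subseteq> H \<longrightarrow> p \<in> T \<and> q \<in> T)"

text \<open>The last clause excludes the inversion of an edge, which would leave an involution
  without a fixed vertex.\<close>

definition involution :: "('v \<Rightarrow> 'v) \<Rightarrow> bool" where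
  "involution x \<longleftrightarrow> (\<forall>v\<in>V. x v \<in> V \<and> x (x v) = v) \<and> (\<forall>u v. adj u v \<longrightarrow> adj (x u) (x v)) \<and>
     (\<forall>u v. adj u v \<longrightarrow> x u \<noteq> v)"

definition Fix :: "('v \<Rightarrow> 'v) \<Rightarrow> 'v set" where
  "Fix x = {v \<in> V. x v = v}"

section \<open>Half-trees and their images under involutions\<close>

lemma half_cross:
  "half p q H \<Longrightarrow> adj u v \<Longrightarrow> u \<in> H \<Longrightarrow> v \<notin> H \<Longrightarrow> u = p \<and> v = q"
  unfolding half_tree_def by blast

lemma half_ends:
  "half p q H \<Longrightarrow> adj p q \<and> H \<subseteq> V \<and> p \<in> H \<and> p \<in> V \<and> q \<in> V \<and> q \<notin> H"
  unfolding half_tree_def by blast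

lemma convexD:
  "convex T \<Longrightarrow> half p q H \<Longrightarrow> u \<in> T \<Longrightarrow> u \<in> H \<Longrightarrow> v \<in> T \<Longrightarrow> v \<notin> H \<Longrightarrow> p \<in> T \<and> q \<in> T"
  unfolding convex_def by blast

lemma half_Diff:
  assumes "half p q H" shows "half q p (V - H)"
  using assms adj_in adj_sym unfolding half_tree_def by blast

text \<open>Induct along a path of the tree from \<open>p\<close>: whenever it re-enters
  \<open>H\<close>, it does so at \<open>p\<close>, which is in \<open>K\<close>.\<close>

lemma half_subset:
  assumes H: "half p q H" and "p \<in> K"
    and step: "\<And>u v. adj u v \<Longrightarrow> u \<in> H \<Longrightarrow> v \<in> H \<Longrightarrow> u \<in> K \<Longrightarrow> v \<in> K"
  shows "H \<subseteq> K"
proof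
  fix v assume "v \<in> H"
  have "adj\<^sup>*\<^sup>* p v" using H \<open>v \<in> H\<close> conn unfolding half_tree_def by blast
  then show "v \<in> K" using \<open>v \<in> H\<close>
  proof (induction rule: rtranclp_induct)
    case base then show ?case using \<open>p \<in> K\<close> by simp
  next
    case (step y z)
    show ?case
    proof (cases "y \<in> H")
      case True then show ?thesis using step assms(3) by blast
    next
      case False
      then have "z = p" using H step(2,4) adj_sym unfolding half_tree_def by blast
      then show ?thesis using \<open>p \<in> K\<close> by simp
    qed
  qed
qed

text \<open>The second edge lies on one side of the first. The half-tree of the first edge on the
  other side cannot cross the second edge, so it lies wholly in \<open>H'\<close> or wholly
  outside.\<close>

lemma half_nested:
  assumes H: "half p q H" and H': "half p' q' H'" and ne: "{p, q} \<noteq> {p', q'}"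
  shows "H \<subseteq> H' \<or> H \<inter> H' = {} \<or> V - H \<subseteq> H' \<or> H' \<subseteq> H"
proof -
  have dich: "K \<subseteq> H' \<or> K \<inter> H' = {}" if K: "half r s K" and out: "p' \<notin> K \<or> q' \<notin> K" for r s K
  proof (cases "r \<in> H'")
    case True
    have "K \<subseteq> H'"
      using K True by (rule half_subset) (use out half_cross[OF H'] in blast)
    then show ?thesis by simp
  next
    case False
    have "K \<subseteq> - H'"
      using K by (rule half_subset) (use False out half_cross[OF H'] adj_sym in blast)+
    then show ?thesis by auto
  qed
  have "p' \<in> H \<longleftrightarrow> q' \<in> H"
    using half_cross[OF H, of p' q'] half_cross[OF H, of q' p'] half_ends[OF H'] ne adj_sym by blast
  then consider "p' \<notin> H" | "p' \<notin> V - H" by blast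
  then show ?thesis
  proof cases
    case 1 then show ?thesis using dich[OF H] by blast
  next
    case 2
    then have "V - H \<subseteq> H' \<or> (V - H) \<inter> H' = {}" using dich[OF half_Diff[OF H]] by blast
    moreover have "H' \<subseteq> V" using half_ends[OF H'] by simp
    ultimately show ?thesis by blast
  qed
qed

lemma half_image:
  assumes x: "involution x" and H: "half p q H"
  shows "half (x p) (x q) (x ` H)"
proof -
  have mem: "v \<in> x ` H \<longleftrightarrow> x v \<in> H" if "v \<in> V" for v
    using x H that unfolding involution_def half_tree_def by (metis image_iff subsetD)
  have qV: "q \<in> V" "q \<notin> H" "p \<in> H" "p \<in> V" "H \<subseteq> V" "adj p q"
    using half_ends[OF H] by auto
  have "x u \<in> V" "x (x u) = u" if "u \<in> V" for u using x that by (auto simp: involution_def)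
  note xV = this
  have "\<forall>u v. adj u v \<longrightarrow> u \<in> x ` H \<longrightarrow> v \<notin> x ` H \<longrightarrow> u = x p \<and> v = x q"
  proof (intro allI impI)
    fix u v assume uv: "adj u v" "u \<in> x ` H" "v \<notin> x ` H"
    have V: "u \<in> V" "v \<in> V" using uv adj_in by auto
    then have "adj (x u) (x v)" "x u \<in> H" "x v \<notin> H" using uv mem x by (auto simp: involution_def)
    then have "x u = p" "x v = q" using half_cross[OF H] by blast+
    then show "u = x p \<and> v = x q" using xV V by metis
  qed
  moreover have "adj (x p) (x q)" using x qV by (auto simp: involution_def)
  moreover have "x q \<notin> x ` H" using qV mem xV by metis
  moreover have "x ` H \<subseteq> V" "x p \<in> x ` H" "x q \<in> V" using qV xV by auto
  ultimately show ?thesis unfolding half_tree_def Diff_iff by (intro conjI)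
qed

text \<open>Applying \<open>x\<close> reverses an inclusion between \<open>H\<close> and its image,
  so such an inclusion is an equality, and then the only edge leaving \<open>H\<close> is
  fixed.\<close>

lemma half_involution:
  assumes x: "involution x" and H: "half p q H"
  shows "(x p = p \<and> x q = q) \<or> H \<inter> x ` H = {} \<or> H \<union> x ` H = V"
proof -
  have HV: "H \<subseteq> V" and pq: "adj p q" using half_ends[OF H] by auto
  have xV: "x u \<in> V" "x (x u) = u" if "u \<in> V" for u using x that by (auto simp: involution_def)
  have H': "half (x p) (x q) (x ` H)" using half_image[OF x H] .
  have xx: "x ` x ` H = H" using xV HV by (force simp: image_image)
  have eq: "x p = p \<and> x q = q" if "x ` H = H"
    using half_cross[OF H', of p q] half_ends[OF H] that by simp
  show ?thesis
  proof (cases "{p, q} = {x p, x q}")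
    case True
    moreover have "x p \<noteq> q" using x pq unfolding involution_def by blast
    ultimately show ?thesis by (auto simp: doubleton_eq_iff)
  next
    case False
    from half_nested[OF H H' False] consider "H \<subseteq> x ` H" | "H \<inter> x ` H = {}" | "V - H \<subseteq> x ` H" | "x ` H \<subseteq> H"
      by blast
    then show ?thesis
    proof cases
      case 1
      then have "x ` H \<subseteq> H" using xx by (metis image_mono)
      then show ?thesis using 1 eq by blast
    next
      case 2 then show ?thesis by simp
    next
      case 3
      moreover have "x ` H \<subseteq> V" using HV xV by auto
      ultimately show ?thesis using HV by blast
    next
      case 4
      then have "H \<subseteq> x ` H" using xx by (metis image_mono)
      then show ?thesis using 4 eq by blast
    qed
  qed
qed

text \<open>A fixed vertex in \<open>H\<close> is also in the image of \<open>H\<close>, and a fixed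
  vertex outside \<open>H\<close> is outside both; so the two half-trees are neither disjoint nor do
  they cover \<open>V\<close>.\<close>

lemma convex_Fix:
  assumes x: "involution x" shows "convex (Fix x)"
  unfolding convex_def
proof (intro conjI allI impI)
  show "Fix x \<subseteq> V" by (auto simp: Fix_def)
  fix p q H
  assume H: "half p q H" and "Fix x \<inter> H \<noteq> {}" "\<not> Fix x \<subseteq> H"
  then obtain u v where uv: "x u = u" "u \<in> H" "x v = v" "v \<in> V" "v \<notin> H" by (auto simp: Fix_def)
  have xV: "x u \<in> V" "x (x u) = u" if "u \<in> V" for u using x that by (auto simp: involution_def)
  have "u \<in> x ` H" using uv by force
  moreover have "v \<notin> x ` H"
  proof
    assume "v \<in> x ` H"
    then obtain h where "h \<in> H" "v = x h" by blast
    then have "h = x v" using xV H by (metis half_tree_def subsetD)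
    then show False using \<open>h \<in> H\<close> uv by simp
  qed
  ultimately have "x p = p \<and> x q = q" using half_involution[OF x H] uv by blast
  then show "p \<in> Fix x" "q \<in> Fix x" using half_ends[OF H] by (auto simp: Fix_def)
qed

section \<open>Subtrees: separation by an edge and the Helly property\<close>

lemma convex_Inter:
  assumes "\<And>i. i \<in> I \<Longrightarrow> convex (T i)" and "I \<noteq> {}"
  shows "convex (\<Inter>i\<in>I. T i)"
  unfolding convex_def
proof (intro conjI allI impI)
  show "(\<Inter>i\<in>I. T i) \<subseteq> V" using assms unfolding convex_def by blast
  fix p q H
  assume H: "half p q H" and 1: "(\<Inter>i\<in>I. T i) \<inter> H \<noteq> {}" and 2: "\<not> (\<Inter>i\<in>I. T i) \<subseteq> H"
  have "p \<in> T i \<and> q \<in> T i" if "i \<in> I" for i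
  proof -
    from 1 obtain u where u: "u \<in> (\<Inter>i\<in>I. T i)" "u \<in> H" by blast
    from 2 obtain v where v: "v \<in> (\<Inter>i\<in>I. T i)" "v \<notin> H" by blast
    from that u v have "u \<in> T i" "v \<in> T i" by simp_all
    then show ?thesis by (rule convexD[OF assms(1)[OF that] H _ u(2) _ v(2)])
  qed
  then show "p \<in> (\<Inter>i\<in>I. T i)" "q \<in> (\<Inter>i\<in>I. T i)" by auto
qed

lemma convex_separation:
  assumes U: "convex U" "U \<noteq> {}" and T: "convex T" "T \<noteq> {}" and disj: "U \<inter> T = {}"
  obtains p q H where "half p q H" "U \<subseteq> H" "T \<subseteq> V - H"
proof -
  obtain u t where ut: "u \<in> U" "t \<in> T" using U(2) T(2) by blast
  have "u \<in> V" "t \<in> V" using ut U(1) T(1) unfolding convex_def by blast+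
  then have "adj\<^sup>*\<^sup>* u t" by (rule conn)
  \<comment> \<open>Invariant along the path: its current vertex is in \<open>U\<close> or lies
    beyond some edge that leaves \<open>U\<close>. Crossing that edge backwards leads to
    \<open>p\<close>, hence into \<open>U\<close>.\<close>
  then have "t \<in> U \<or> (\<exists>p q H. half p q H \<and> p \<in> U \<and> q \<notin> U \<and> t \<notin> H)"
  proof (induction rule: rtranclp_induct)
    case base then show ?case using ut by simp
  next
    case (step y z)
    from step.IH show ?case
    proof
      assume "y \<in> U"
      obtain H where "half y z H" using bridge step by blast
      then show ?thesis using \<open>y \<in> U\<close> unfolding half_tree_def by blast
    next
      assume "\<exists>p q H. half p q H \<and> p \<in> U \<and> q \<notin> U \<and> y \<notin> H"
      then obtain p q H where pq: "half p q H" "p \<in> U" "q \<notin> U" "y \<notin> H" by blast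
      show ?thesis
      proof (cases "z \<in> H")
        case True
        then have "z = p" using half_cross[OF pq(1)] pq(4) step(2) adj_sym by blast
        then show ?thesis using pq by simp
      next
        case False then show ?thesis using pq by blast
      qed
    qed
  qed
  then obtain p q H where pq: "half p q H" "p \<in> U" "q \<notin> U" "t \<notin> H" using ut disj by blast
  have "p \<in> H" using half_ends[OF pq(1)] by blast
  have "U \<subseteq> H" using convexD[OF U(1) pq(1)] pq \<open>p \<in> H\<close> by blast
  moreover have "T \<subseteq> V" using T(1) unfolding convex_def by blast
  then have "T \<subseteq> V - H" using convexD[OF T(1) pq(1)] pq ut disj by blast
  ultimately show thesis using that pq by blast
qed

text \<open>An edge separating the new tree from the intersection of the earlier ones is straddled
  by each earlier tree, so its far end \<open>q\<close> would lie in that intersection.\<close>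

lemma helly:
  assumes "finite I" "I \<noteq> {}" and T: "\<And>i. i \<in> I \<Longrightarrow> convex (T i)"
    and meet: "\<And>i j. i \<in> I \<Longrightarrow> j \<in> I \<Longrightarrow> T i \<inter> T j \<noteq> {}"
  shows "(\<Inter>i\<in>I. T i) \<noteq> {}"
  using assms
proof (induction I rule: finite_ne_induct)
  case (singleton i) then show ?case by force
next
  case (insert i I)
  let ?U = "\<Inter>j\<in>I. T j"
  have U: "convex ?U" using convex_Inter[of I T] insert.prems(1) insert.hyps(2) by blast
  have U0: "?U \<noteq> {}" by (rule insert.IH) (use insert.prems in blast)+
  have Ti: "convex (T i)" "T i \<noteq> {}" using insert.prems(1) insert.prems(2)[of i i] by blast+
  obtain u where u: "u \<in> ?U" using U0 by (rule ex_in_conv[THEN iffD2, THEN exE])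
  show ?case
  proof (rule ccontr)
    assume "\<not> ?thesis"
    then have "?U \<inter> T i = {}" by auto
    then obtain p q H where H: "half p q H" "?U \<subseteq> H" "T i \<subseteq> V - H"
      using convex_separation[OF U U0 Ti] by blast
    have "p \<in> T j \<and> q \<in> T j" if "j \<in> I" for j
    proof -
      have uj: "u \<in> T j" "u \<in> H" using that u subsetD[OF H(2) u] by simp_all
      have "T j \<inter> T i \<noteq> {}" using insert.prems(2)[of j i] that by blast
      then obtain v where v: "v \<in> T j" "v \<notin> H" using H(3) by blast
      have "convex (T j)" using insert.prems(1) that by blast
      then show ?thesis by (rule convexD[OF _ H(1) uj v])
    qed
    then have "q \<in> ?U" by simp
    then have "q \<in> H" by (rule subsetD[OF H(2)])
    then show False using half_ends[OF H(1)] by simp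
  qed
qed

text \<open>The path enters \<open>H\<close> from \<open>q\<close> to \<open>p\<close>. The pieces
  before and after this edge are strictly shorter, as the minimality arguments require.\<close>

lemma path_cross:
  assumes H: "half p q H" and "(adj ^^ k) u w" "u \<notin> H" "w \<in> H"
  shows "\<exists>j l. j < k \<and> l < k \<and> (adj ^^ j) u q \<and> (adj ^^ l) p w"
  using assms(2-)
proof (induction k arbitrary: w)
  case 0 then show ?case by simp
next
  case (Suc k)
  then obtain y where y: "(adj ^^ k) u y" "adj y w" by auto
  show ?case
  proof (cases "y \<in> H")
    case True
    then obtain j l where "j < k" "l < k" "(adj ^^ j) u q" "(adj ^^ l) p y" using Suc y by blast
    then have "(adj ^^ Suc l) p w" using y by auto
    then show ?thesis using \<open>j < k\<close> \<open>l < k\<close> \<open>(adj ^^ j) u q\<close> by (meson Suc_mono less_SucI)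
  next
    case False
    then have "w = p" "y = q" using half_cross[OF H] y Suc.prems adj_sym by blast+
    then show ?thesis using y by (intro exI[of _ k] exI[of _ 0]) auto
  qed
qed

text \<open>A vertex moved the least distance is fixed: otherwise its neighbour towards the image
  would be moved less.\<close>
lemma Fix_nonempty:
  assumes x: "involution x" and "V \<noteq> {}"
  shows "Fix x \<noteq> {}"
proof -
  have xV: "x u \<in> V" "x (x u) = u" if "u \<in> V" for u using x that by (auto simp: involution_def)
  let ?Q = "\<lambda>n. \<exists>v\<in>V. (adj ^^ n) v (x v)"
  obtain v0 where "v0 \<in> V" using assms by blast
  then have "\<exists>n. (adj ^^ n) v0 (x v0)" using conn xV by (metis rtranclp_imp_relpowp)
  then have ex: "\<exists>n. ?Q n" using \<open>v0 \<in> V\<close> by blast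
  define n where "n = (LEAST n. ?Q n)"
  have "?Q n" unfolding n_def using ex by (rule LeastI_ex)
  then obtain v where v: "v \<in> V" "(adj ^^ n) v (x v)" by blast
  have least: "n \<le> k" if "?Q k" for k unfolding n_def using that by (rule Least_le)
  show ?thesis
  proof (cases n)
    case 0
    then show ?thesis using v by (auto simp: Fix_def)
  next
    case (Suc k)
    then obtain w where w: "adj v w" "(adj ^^ k) w (x v)" using v by (metis relpowp_Suc_D2)
    obtain H where H: "half v w H" using bridge w by blast
    have vw: "v \<in> H" "w \<notin> H" "w \<in> V" "H \<subseteq> V" using half_ends[OF H] by auto
    \<comment> \<open>Otherwise the path from \<open>w\<close> would return through \<open>v\<close>
      and leave a shorter path from \<open>v\<close> to \<open>x v\<close>.\<close>
    have xvH: "x v \<notin> H"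
    proof
      assume "x v \<in> H"
      then obtain l where "l < k" "(adj ^^ l) v (x v)" using path_cross[OF H w(2)] vw by blast
      then show False using least[of l] v Suc by auto
    qed
    then have "v \<notin> x ` H" using vw xV by (metis imageE subsetD)
    have H': "half (x v) (x w) (x ` H)" using half_image[OF x H] .
    have "w \<notin> x ` H"
    proof
      assume "w \<in> x ` H"
      then have "w = x v" using half_cross[OF H'] w \<open>v \<notin> x ` H\<close> adj_sym by blast
      then show False using x w unfolding involution_def by blast
    qed
    moreover have "x v \<in> x ` H" using vw by blast
    \<comment> \<open>The path enters the image half-tree through \<open>x w\<close>, so it reaches
      \<open>x w\<close> from \<open>w\<close> in fewer than \<open>n\<close> steps.\<close>
    ultimately obtain j where "j < k" "(adj ^^ j) w (x w)" using path_cross[OF H' w(2)] by blast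
    then show ?thesis using least[of j] vw Suc by auto
  qed
qed

text \<open>If the fixed trees were disjoint, an edge separating them would be a ping-pong
  table for \<open>x\<close> and \<open>y\<close>, and \<open>x \<circ> y\<close> would shrink its half-tree.\<close>
lemma Fix_meet:
  assumes x: "involution x" and y: "involution y" and "V \<noteq> {}"
    and ord: "\<And>v. v \<in> V \<Longrightarrow> ((x \<circ> y) ^^ n) v = v" and "n > 0"
  shows "Fix x \<inter> Fix y \<noteq> {}"
proof
  assume disj: "Fix x \<inter> Fix y = {}"
  have xV: "x u \<in> V" "x (x u) = u" if "u \<in> V" for u using x that by (auto simp: involution_def)
  have yV: "y u \<in> V" "y (y u) = u" if "u \<in> V" for u using y that by (auto simp: involution_def)
  have ne: "Fix x \<noteq> {}" "Fix y \<noteq> {}" using Fix_nonempty x y \<open>V \<noteq> {}\<close> by auto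
  obtain p q H where H: "half p q H" and xH: "Fix x \<subseteq> H" and yH: "Fix y \<subseteq> V - H"
    using convex_separation[OF convex_Fix[OF x] ne(1) convex_Fix[OF y] ne(2) disj] by blast
  have pq: "p \<in> H" "p \<in> V" "q \<in> V" "q \<notin> H" "H \<subseteq> V" using half_ends[OF H] by auto
  obtain u where u: "u \<in> V" "x u = u" "u \<in> H" using ne xH by (auto simp: Fix_def)
  obtain w where w: "w \<in> V" "y w = w" "w \<notin> H" using ne yH by (auto simp: Fix_def)
  have "x q \<noteq> q" using xH pq by (auto simp: Fix_def)
  moreover have "H \<inter> x ` H \<noteq> {}" using u by force
  ultimately have X: "H \<union> x ` H = V" using half_involution[OF x H] by blast
  have "y p \<noteq> p" using yH pq by (auto simp: Fix_def)
  moreover have "w \<notin> H \<union> y ` H"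
    using w yV pq by (metis UnE imageE subsetD)
  ultimately have Y: "H \<inter> y ` H = {}" using half_involution[OF y H] w by blast
  \<comment> \<open>\<open>y\<close> moves \<open>H\<close> off itself and \<open>x\<close> brings
    the outside of \<open>H\<close> back in. The vertex \<open>u\<close> is missed: it is fixed by
    \<open>x\<close> and is not outside \<open>H\<close>.\<close>
  have xy: "x (y v) \<in> H" "x (y v) \<noteq> u" if "v \<in> H" for v
  proof -
    have "y v \<in> V" "y v \<notin> H" using that Y yV pq by auto
    then obtain h where h: "h \<in> H" "y v = x h" using X by auto
    then have xyh: "x (y v) = h" using xV pq by auto
    then show "x (y v) \<in> H" using h by simp
    show "x (y v) \<noteq> u" using xyh h u \<open>y v \<notin> H\<close> by auto
  qed
  have "((x \<circ> y) ^^ k) v \<in> H" if "v \<in> H" for k v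
    using that by (induction k) (auto simp: xy)
  moreover obtain k where "n = Suc k" using \<open>n > 0\<close> gr0_implies_Suc by blast
  ultimately have "((x \<circ> y) ^^ n) u \<noteq> u" using xy u by simp
  then show False using ord u by simp
qed

text \<open>A subtree that does not contain the edge lies on one side of it, namely on the side of
  its predecessor, which it meets.\<close>

lemma chain_cross:
  fixes T :: "nat \<Rightarrow> 'v set"
  assumes H: "half p q H" and "i < j"
    and T: "\<And>k. convex (T k)" and meet: "\<And>k. T k \<inter> T (Suc k) \<noteq> {}"
    and ends: "T i \<subseteq> H" "T j \<subseteq> V - H"
  shows "\<exists>k. i < k \<and> k < j \<and> p \<in> T k \<and> q \<in> T k"
proof (rule ccontr)
  assume no: "\<not> ?thesis"
  have "k < j \<longrightarrow> T k \<subseteq> H" if "i \<le> k" for k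
    using that
  proof (induction k rule: dec_induct)
    case base then show ?case using ends by simp
  next
    case (step k)
    show ?case
    proof
      assume k: "Suc k < j"
      then have "T k \<subseteq> H" using step.IH by simp
      then obtain u where "u \<in> T (Suc k)" "u \<in> H" using meet[of k] by blast
      moreover have "i < Suc k" using step.hyps by simp
      then have "\<not> (p \<in> T (Suc k) \<and> q \<in> T (Suc k))" using no k by blast
      ultimately show "T (Suc k) \<subseteq> H" using convexD[OF T H] by blast
    qed
  qed
  then have "T (j - 1) \<subseteq> H" using \<open>i < j\<close> by auto
  moreover have "T (j - 1) \<inter> T j \<noteq> {}" using meet[of "j - 1"] \<open>i < j\<close> by simp
  ultimately show False using ends by blast
qed

text \<open>If two of the trees are disjoint, take an edge that separates them: both arcs of the
  cycle between them pass through it, one at \<open>k\<close> and the other at \<open>l\<close>. The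
  inequalities say that \<open>k\<close> and \<open>l\<close> are neither equal nor neighbours
  modulo \<open>n\<close>.\<close>

lemma cycle_cases:
  fixes T :: "nat \<Rightarrow> 'v set"
  assumes "n > 0" and T: "\<And>k. convex (T k)" and per: "\<And>k. T (k + n) = T k"
    and meet: "\<And>k. T k \<inter> T (Suc k) \<noteq> {}"
  shows "(\<Inter>k. T k) \<noteq> {} \<or>
    (\<exists>k l p q. Suc k < l \<and> Suc l < k + n \<and> adj p q \<and> p \<in> T k \<and> q \<in> T k \<and> p \<in> T l \<and> q \<in> T l)"
proof -
  have mod: "T k = T (k mod n)" for k
  proof -
    have "T (r + n * c) = T r" for r c
    proof (induction c)
      case (Suc c)
      have "r + n * Suc c = r + n * c + n" by simp
      then show ?case using Suc per by metis
    qed simp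
    from this[of "k mod n" "k div n"] show ?thesis by (simp add: mult.commute)
  qed
  show ?thesis
  proof (cases "\<forall>i<n. \<forall>j<n. T i \<inter> T j \<noteq> {}")
    case True
    then have "(\<Inter>k\<in>{..<n}. T k) \<noteq> {}"
      by (intro helly) (use T \<open>n > 0\<close> in auto)
    then obtain v where "\<And>k. k < n \<Longrightarrow> v \<in> T k" by blast
    then have "v \<in> T k" for k using mod[of k] \<open>n > 0\<close> by (metis mod_less_divisor)
    then show ?thesis by blast
  next
    case False
    then obtain i j where ij: "i < n" "j < n" "T i \<inter> T j = {}" by blast
    have ne: "T k \<noteq> {}" for k using meet[of k] by blast
    have "\<exists>i j. i < j \<and> j < n \<and> T i \<inter> T j = {}"
    proof (cases i j rule: linorder_cases)
      case less then show ?thesis using ij by blast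
    next
      case equal then show ?thesis using ij ne by simp
    next
      case greater then show ?thesis using ij by blast
    qed
    then obtain i j where ij: "i < j" "j < n" "T i \<inter> T j = {}" by blast
    obtain p q H where H: "half p q H" "T i \<subseteq> H" "T j \<subseteq> V - H"
      using convex_separation[OF T ne T ne ij(3)] by blast
    have "H \<subseteq> V" "adj p q" using half_ends[OF H(1)] by blast+
    obtain k where k: "i < k" "k < j" "p \<in> T k" "q \<in> T k"
      using chain_cross[OF H(1) ij(1) T meet H(2,3)] by blast
    have "V - (V - H) = H" using \<open>H \<subseteq> V\<close> by blast
    then have "T (i + n) \<subseteq> V - (V - H)" using H(2) per by simp
    then obtain l where l: "j < l" "l < i + n" "p \<in> T l" "q \<in> T l"
      using chain_cross[OF half_Diff[OF H(1)] _ T meet H(3), of "i + n"] ij by auto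
    have "Suc k < l" "Suc l < k + n" using k l by auto
    then show ?thesis using k l \<open>adj p q\<close> by blast
  qed
qed

end

section \<open>Clique separators of chordal graphs\<close>

definition induced_path :: "('a \<Rightarrow> 'a \<Rightarrow> bool) \<Rightarrow> 'a list \<Rightarrow> bool" where
  "induced_path E xs \<longleftrightarrow> distinct xs \<and>
     (\<forall>i j. i < j \<longrightarrow> j < length xs \<longrightarrow> (E (xs ! i) (xs ! j) \<longleftrightarrow> j = Suc i))"

lemma induced_path_take:
  "induced_path E xs \<Longrightarrow> induced_path E (take k xs)"
  unfolding induced_path_def by simp

lemma induced_path_exists:
  assumes "(\<lambda>u v. E u v \<and> v \<in> Z)\<^sup>*\<^sup>* x y" and "x \<in> Z"
  shows "\<exists>xs. xs \<noteq> [] \<and> induced_path E xs \<and> hd xs = x \<and> last xs = y \<and> set xs \<subseteq> Z"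
  using assms(1)
proof (induction rule: rtranclp_induct)
  case base
  then show ?case using \<open>x \<in> Z\<close> by (intro exI[of _ "[x]"]) (simp add: induced_path_def)
next
  case (step u v)
  then obtain xs where xs: "xs \<noteq> []" "induced_path E xs" "hd xs = x" "last xs = u" "set xs \<subseteq> Z"
    by blast
  show ?case
  proof (cases "v \<in> set xs")
    case True
    then obtain k where k: "k < length xs" "xs ! k = v" by (meson in_set_conv_nth)
    show ?thesis
    proof (intro exI conjI)
      show "take (Suc k) xs \<noteq> []" using xs by simp
      show "induced_path E (take (Suc k) xs)" using xs induced_path_take by blast
      show "hd (take (Suc k) xs) = x" using xs by simp
      show "last (take (Suc k) xs) = v" using k by (simp add: take_Suc_conv_app_nth)
      show "set (take (Suc k) xs) \<subseteq> Z" using xs set_take_subset by fast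
    qed
  next
    case False
    \<comment> \<open>Going to \<open>v\<close> from the first vertex of the path adjacent to it
      leaves no chord.\<close>
    define k where "k = (LEAST k. k < length xs \<and> E (xs ! k) v)"
    have "length xs - 1 < length xs \<and> E (xs ! (length xs - 1)) v"
      using xs step by (simp add: last_conv_nth)
    then have k: "k < length xs" "E (xs ! k) v" unfolding k_def by (metis (mono_tags, lifting) LeastI)+
    have least: "\<not> E (xs ! i) v" if "i < k" for i
      using not_less_Least[of i] that k unfolding k_def by fastforce
    let ?ys = "take (Suc k) xs @ [v]"
    have "induced_path E ?ys"
      unfolding induced_path_def
    proof (intro conjI allI impI)
      show "distinct ?ys" using xs False set_take_subset[of "Suc k" xs]
        by (auto simp: induced_path_def)
      fix i j assume ij: "i < j" "j < length ?ys"
      show "E (?ys ! i) (?ys ! j) \<longleftrightarrow> j = Suc i"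
      proof (cases "j = Suc k")
        case True
        then show ?thesis using ij k least[of i] by (auto simp: nth_append less_Suc_eq)
      next
        case False
        then show ?thesis using ij k xs by (simp add: nth_append induced_path_def)
      qed
    qed
    then show ?thesis using xs step set_take_subset[of "Suc k" xs]
      by (intro exI[of _ ?ys]) auto
  qed
qed

lemma glue_induced_paths:
  assumes sym: "\<And>u v. E u v \<Longrightarrow> E v u"
    and xs: "xs \<noteq> []" "induced_path E xs" "hd xs = x" "last xs = y" "set xs \<subseteq> X \<union> {x, y}"
    and ws: "ws \<noteq> []" "induced_path E ws" "hd ws = y" "last ws = x" "set ws \<subseteq> Y \<union> {x, y}"
    and disj: "X \<inter> Y = {}" and xy: "x \<noteq> y" "\<not> E x y"
    and no: "\<And>u v. u \<in> X \<Longrightarrow> v \<in> Y \<Longrightarrow> \<not> E u v"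
  shows "\<exists>vs. set vs \<subseteq> X \<union> Y \<union> {x, y} \<and> graph_cycle E vs \<and> 4 \<le> length vs \<and> \<not> has_chord E vs"
proof -
  define p q where "p = length xs" and "q = length ws"
  have xsn: "xs ! 0 = x" "xs ! (p - 1) = y" and wsn: "ws ! 0 = y" "ws ! (q - 1) = x"
    using xs ws by (simp_all add: p_def q_def hd_conv_nth last_conv_nth)
  have dxs: "distinct xs" and dws: "distinct ws" using xs ws by (auto simp: induced_path_def)
  have ix: "xs ! i = xs ! j \<longleftrightarrow> i = j" if "i < p" "j < p" for i j
    using dxs that by (simp add: nth_eq_iff_index_eq p_def)
  have iw: "ws ! i = ws ! j \<longleftrightarrow> i = j" if "i < q" "j < q" for i j
    using dws that by (simp add: nth_eq_iff_index_eq q_def)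
  have Exs: "E (xs ! i) (xs ! j) \<longleftrightarrow> j = Suc i" if "i < j" "j < p" for i j
    using xs that by (simp add: induced_path_def p_def)
  have Ews: "E (ws ! i) (ws ! j) \<longleftrightarrow> j = Suc i" if "i < j" "j < q" for i j
    using ws that by (simp add: induced_path_def q_def)
  have p3: "3 \<le> p"
  proof (rule ccontr)
    assume "\<not> 3 \<le> p"
    moreover have "0 < p" using xs(1) by (simp add: p_def)
    ultimately consider "p = 1" | "p = 2" by linarith
    then show False using xsn xy Exs[of 0 1] by cases auto
  qed
  have q3: "3 \<le> q"
  proof (rule ccontr)
    assume "\<not> 3 \<le> q"
    moreover have "0 < q" using ws(1) by (simp add: q_def)
    ultimately consider "q = 1" | "q = 2" by linarith
    then show False using wsn xy Ews[of 0 1] sym[of y x] by cases auto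
  qed
  have inX: "xs ! i \<in> X" if "0 < i" "i < p - 1" for i
  proof -
    have "xs ! i \<in> X \<union> {x, y}" using that by (intro subsetD[OF xs(5)] nth_mem) (simp add: p_def)
    moreover have "xs ! i \<noteq> xs ! 0" "xs ! i \<noteq> xs ! (p - 1)"
      using ix[of i 0] ix[of i "p - 1"] that p3 by auto
    ultimately show ?thesis using xsn by auto
  qed
  have inY: "ws ! i \<in> Y" if "0 < i" "i < q - 1" for i
  proof -
    have "ws ! i \<in> Y \<union> {x, y}" using that by (intro subsetD[OF ws(5)] nth_mem) (simp add: q_def)
    moreover have "ws ! i \<noteq> ws ! 0" "ws ! i \<noteq> ws ! (q - 1)"
      using iw[of i 0] iw[of i "q - 1"] that q3 by auto
    ultimately show ?thesis using wsn by auto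
  qed
  \<comment> \<open>The ends of \<open>ws\<close> are dropped because they are \<open>y\<close> and
    \<open>x\<close> again. So position \<open>p - 1\<close> can be read in either path, and the
    last position is adjacent to position 0.\<close>
  define vs where "vs = xs @ butlast (tl ws)"
  define n where "n = p + q - 2"
  have len: "length vs = n" using q3 by (simp add: vs_def n_def p_def q_def)
  have v1: "vs ! i = xs ! i" if "i < p" for i using that by (simp add: vs_def nth_append p_def)
  have v2: "vs ! i = ws ! (i + 1 - p)" if "p - 1 \<le> i" "i < n" for i
  proof (cases "i < p")
    case True
    then have "i = p - 1" using that by simp
    then show ?thesis using p3 v1 xsn wsn by simp
  next
    case False
    then show ?thesis
      using that p3 q3 by (simp add: vs_def nth_append p_def q_def n_def nth_butlast nth_tl Suc_diff_le)
  qed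
  have w2: "vs ! i = ws ! (i + 1 - p) \<and> ws ! (i + 1 - p) \<in> Y" if "p \<le> i" "i < n" for i
    using v2[of i] inY[of "i + 1 - p"] that q3 by (auto simp: n_def)
  have sub: "set vs \<subseteq> X \<union> Y \<union> {x, y}"
  proof -
    have "set (butlast (tl ws)) \<subseteq> set ws" by (cases ws) (auto dest: in_set_butlastD)
    then show ?thesis using xs(5) ws(5) unfolding vs_def set_append by blast
  qed
  have adj: "E (vs ! i) (vs ! j) \<longleftrightarrow> j = Suc i \<or> (i = 0 \<and> j = n - 1)" if ij: "i < j" "j < n" for i j
  proof -
    consider "j < p" | "p - 1 \<le> i" | "i = 0" "p \<le> j" | "0 < i" "i < p - 1" "p \<le> j" by linarith
    then show ?thesis
    proof cases
      case 1
      then show ?thesis using v1[of i] v1[of j] Exs[of i j] ij q3 by (auto simp: n_def)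
    next
      case 2
      have "i + 1 - p < j + 1 - p \<or> i = p - 1" using 2 ij by linarith
      show ?thesis
      proof (cases "i = p - 1")
        case True
        have "vs ! i = ws ! 0" "vs ! j = ws ! (j + 1 - p)"
          using True p3 v1[of i] xsn wsn v2[of j] ij by auto
        moreover have "E (ws ! 0) (ws ! (j + 1 - p)) \<longleftrightarrow> j + 1 - p = Suc 0"
          using Ews[of 0 "j + 1 - p"] ij p3 True by (simp add: n_def)
        ultimately show ?thesis using True ij p3 by auto
      next
        case False
        then have "p \<le> i" using 2 by simp
        then have "E (vs ! i) (vs ! j) \<longleftrightarrow> j + 1 - p = Suc (i + 1 - p)"
          using v2[of i] v2[of j] Ews[of "i + 1 - p" "j + 1 - p"] ij by (simp add: n_def)
        then show ?thesis using \<open>p \<le> i\<close> ij p3 by auto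
      qed
    next
      case 3
      have "vs ! i = ws ! (q - 1)" using 3 v1[of 0] xsn wsn p3 by simp
      moreover have "E (ws ! (j + 1 - p)) (ws ! (q - 1)) \<longleftrightarrow> q - 1 = Suc (j + 1 - p)"
        using Ews[of "j + 1 - p" "q - 1"] ij 3 q3 by (simp add: n_def)
      moreover have "vs ! j = ws ! (j + 1 - p)" using w2[of j] 3 ij by simp
      moreover have "E (vs ! i) (vs ! j) \<longleftrightarrow> E (vs ! j) (vs ! i)" using sym by blast
      ultimately have "E (vs ! i) (vs ! j) \<longleftrightarrow> q - 1 = Suc (j + 1 - p)" by simp
      also have "\<dots> \<longleftrightarrow> j = n - 1" using 3 ij p3 q3 by (auto simp: n_def)
      finally show ?thesis using 3 p3 by auto
    next
      case 4
      then have "vs ! i \<in> X" "vs ! j \<in> Y" using v1[of i] inX[of i] w2[of j] ij by auto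
      then show ?thesis using no 4 by auto
    qed
  qed
  have "distinct vs"
    unfolding distinct_conv_nth len
  proof (intro allI impI)
    have "vs ! i \<noteq> vs ! j" if ij: "i < j" "j < n" for i j
    proof (cases "j < p")
      case True
      then show ?thesis using v1[of i] v1[of j] ij ix[of i j] by simp
    next
      case False
      then have Yj: "vs ! j = ws ! (j + 1 - p)" "vs ! j \<in> Y" using w2[of j] ij by auto
      consider "p \<le> i" | "i = p - 1" | "i = 0" | "0 < i" "i < p - 1" by linarith
      then show ?thesis
      proof cases
        case 1
        then show ?thesis using Yj v2[of i] ij p3 iw[of "i + 1 - p" "j + 1 - p"] by (simp add: n_def)
      next
        case 2
        then have "vs ! i = ws ! 0" using v1[of i] xsn wsn p3 by simp
        then show ?thesis using Yj ij p3 False iw[of 0 "j + 1 - p"] by (simp add: n_def)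
      next
        case 3
        then have "vs ! i = ws ! (q - 1)" using v1[of i] xsn wsn p3 by simp
        then show ?thesis using Yj ij p3 q3 False iw[of "q - 1" "j + 1 - p"] by (auto simp: n_def)
      next
        case 4
        then have "vs ! i \<in> X" using v1[of i] inX by simp
        then show ?thesis using Yj disj by auto
      qed
    qed
    then show "vs ! i \<noteq> vs ! j" if "i < n" "j < n" "i \<noteq> j" for i j
      using that by (metis linorder_neqE_nat)
  qed
  have n4: "4 \<le> n" using p3 q3 by (simp add: n_def)
  have "E (vs ! i) (vs ! ((i + 1) mod n))" if "i < n" for i
  proof (cases "i = n - 1")
    case True
    then have "(i + 1) mod n = 0" using n4 by simp
    then show ?thesis using adj[of 0 "n - 1"] n4 True sym[of "vs ! 0" "vs ! (n - 1)"] by simp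
  next
    case False
    then show ?thesis using adj[of i "i + 1"] that by simp
  qed
  then have "graph_cycle E vs" using \<open>distinct vs\<close> n4 len by (simp add: graph_cycle_def)
  moreover have "\<not> has_chord E vs"
  proof
    assume "has_chord E vs"
    then obtain i j where ij: "i < n" "j < n" "i \<noteq> j" "j \<noteq> (i + 1) mod n" "i \<noteq> (j + 1) mod n"
      "E (vs ! i) (vs ! j)" unfolding has_chord_def len by blast
    have "\<not> E (vs ! i) (vs ! j)" if "i < j" "j < n" "j \<noteq> (i + 1) mod n" "i \<noteq> (j + 1) mod n" for i j
      using adj[of i j] that by auto
    then show False using ij sym by (metis linorder_neqE_nat)
  qed
  ultimately show ?thesis using sub n4 len by auto
qed

text \<open>A separator of \<open>a\<close> and \<open>b\<close> of least cardinality is a clique: every vertex of it has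
  neighbours in the components of both, so two non-adjacent ones would lie on a chordless cycle.\<close>
lemma clique_separation:
  assumes fin: "finite S" and chordal: "chordal_graph S E"
    and sym: "\<And>u v. E u v \<Longrightarrow> E v u" and ES: "\<And>u v. E u v \<Longrightarrow> u \<in> S \<and> v \<in> S"
    and ab: "a \<in> S" "b \<in> S" "a \<noteq> b" "\<not> E a b"
  obtains A B where "A \<union> B = S" "a \<in> A - B" "b \<in> B - A"
    "\<And>u v. u \<in> A - B \<Longrightarrow> v \<in> B - A \<Longrightarrow> \<not> E u v"
    "\<And>u v. u \<in> A \<inter> B \<Longrightarrow> v \<in> A \<inter> B \<Longrightarrow> u \<noteq> v \<Longrightarrow> E u v"
proof -
  define R where "R C u v \<longleftrightarrow> E u v \<and> u \<in> S - C \<and> v \<in> S - C" for C u v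
  have Rsym: "R C v u" if "R C u v" for C u v using that sym[of u v] by (simp add: R_def)
  have Rsyms: "(R C)\<^sup>*\<^sup>* v u" if "(R C)\<^sup>*\<^sup>* u v" for C u v
    using that
    by (induction rule: rtranclp_induct) (auto intro: converse_rtranclp_into_rtranclp Rsym)
  define sep where "sep C \<longleftrightarrow> C \<subseteq> S - {a, b} \<and> \<not> (R C)\<^sup>*\<^sup>* a b" for C
  have "\<not> (R (S - {a, b}))\<^sup>*\<^sup>* a b"
  proof
    assume "(R (S - {a, b}))\<^sup>*\<^sup>* a b"
    then have "b = a \<or> E a b"
    proof (induction rule: rtranclp_induct)
      case (step y z)
      then show ?case using ab by (auto simp: R_def)
    qed simp
    then show False using ab by auto
  qed
  then have "sep (S - {a, b})" by (simp add: sep_def)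
  from ex_has_least_nat[of sep, OF this, of card]
  obtain C where sepC: "sep C" and min: "\<And>D. sep D \<Longrightarrow> card C \<le> card D" by blast
  have C: "C \<subseteq> S - {a, b}" "\<not> (R C)\<^sup>*\<^sup>* a b" using sepC by (simp_all add: sep_def)
  define comp where "comp c = {v. (R C)\<^sup>*\<^sup>* c v}" for c
  have comp_sub: "comp c \<subseteq> S - C" if "c \<in> S - C" for c
  proof
    fix v assume "v \<in> comp c"
    then have "(R C)\<^sup>*\<^sup>* c v" by (simp add: comp_def)
    then show "v \<in> S - C" using that by (cases rule: rtranclp.cases) (auto simp: R_def)
  qed
  have comp_step: "w \<in> comp c" if "v \<in> comp c" "E v w" "v \<in> S - C" "w \<in> S - C" for c v w
    using that unfolding comp_def R_def by (auto intro: rtranclp.rtrancl_into_rtrancl)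
  have aC: "a \<in> S - C" and bC: "b \<in> S - C" using C ab by auto
  have disj: "comp a \<inter> comp b = {}"
  proof (rule ccontr)
    assume "comp a \<inter> comp b \<noteq> {}"
    then obtain v where "(R C)\<^sup>*\<^sup>* a v" "(R C)\<^sup>*\<^sup>* b v" by (auto simp: comp_def)
    then have "(R C)\<^sup>*\<^sup>* a b" using Rsyms rtranclp_trans by metis
    then show False using C by blast
  qed
  \<comment> \<open>By minimality \<open>C - {x}\<close> does not separate \<open>a\<close> from
    \<open>b\<close>. A walk from \<open>c\<close> to \<open>d\<close> avoiding it can leave the
    component of \<open>c\<close> only through \<open>x\<close>.\<close>
  have nbr: "\<exists>u\<in>comp c. E x u"
    if cd: "(c = a \<and> d = b) \<or> (c = b \<and> d = a)" and x: "x \<in> C" for c d x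
  proof (rule ccontr)
    assume no: "\<not> ?thesis"
    have "finite C" using C fin finite_subset by blast
    then have "card (C - {x}) < card C" using x by (meson card_Diff1_less)
    then have "\<not> sep (C - {x})" using min leD by blast
    then have "(R (C - {x}))\<^sup>*\<^sup>* a b" using C(1) unfolding sep_def by blast
    then have "(R (C - {x}))\<^sup>*\<^sup>* c d" using cd Rsyms by blast
    then have "d \<in> comp c"
    proof (induction rule: rtranclp_induct)
      case base then show ?case by (simp add: comp_def)
    next
      case (step v w)
      have c: "c \<in> S - C" using cd aC bC by auto
      have "v \<in> S - C" using comp_sub[OF c] step by blast
      moreover have "w \<noteq> x" using no step(2,3) sym[of v w] by (auto simp: R_def)
      ultimately show ?case using step comp_step by (auto simp: R_def)
    qed
    moreover have "d \<in> comp d" by (simp add: comp_def)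
    ultimately show False using cd disj by auto
  qed
  have path: "\<exists>xs. xs \<noteq> [] \<and> induced_path E xs \<and> hd xs = x \<and> last xs = y \<and> set xs \<subseteq> comp c \<union> {x, y}"
    if c: "c = a \<or> c = b" and xy: "x \<in> C" "y \<in> C" for c x y
  proof -
    define Q where "Q = (\<lambda>u v. E u v \<and> v \<in> comp c \<union> {x, y})"
    obtain u where u: "u \<in> comp c" "E x u" using nbr[of c _ x] c xy by blast
    obtain w where w: "w \<in> comp c" "E y w" using nbr[of c _ y] c xy by blast
    have "(R C)\<^sup>*\<^sup>* u w"
      using u w Rsyms rtranclp_trans unfolding comp_def by (metis mem_Collect_eq)
    then have "Q\<^sup>*\<^sup>* u w \<and> w \<in> comp c"
    proof (induction rule: rtranclp_induct)
      case base then show ?case using u by simp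
    next
      case (step v z)
      then have "z \<in> comp c" using comp_step by (auto simp: R_def)
      moreover have "Q v z" using step \<open>z \<in> comp c\<close> by (auto simp: R_def Q_def)
      ultimately show ?case using step by (meson rtranclp.rtrancl_into_rtrancl)
    qed
    moreover have "Q x u" using u by (simp add: Q_def)
    moreover have "Q w y" using w sym[of y w] by (simp add: Q_def)
    ultimately have "Q\<^sup>*\<^sup>* x y"
      by (meson converse_rtranclp_into_rtranclp rtranclp.rtrancl_into_rtrancl)
    then show ?thesis unfolding Q_def by (rule induced_path_exists) simp
  qed
  have clique: "E x y" if xy: "x \<in> C" "y \<in> C" "x \<noteq> y" for x y
  proof (rule ccontr)
    assume "\<not> E x y"
    obtain xs where xs: "xs \<noteq> []" "induced_path E xs" "hd xs = x" "last xs = y"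
      "set xs \<subseteq> comp a \<union> {x, y}" using path[of a x y] xy by blast
    obtain ws where ws: "ws \<noteq> []" "induced_path E ws" "hd ws = y" "last ws = x"
      "set ws \<subseteq> comp b \<union> {x, y}" using path[of b y x] xy by blast
    have "\<not> E u v" if "u \<in> comp a" "v \<in> comp b" for u v
    proof
      assume "E u v"
      then have "v \<in> comp a" using comp_step that comp_sub[OF aC] comp_sub[OF bC] by blast
      then show False using disj that by blast
    qed
    then obtain vs where "set vs \<subseteq> comp a \<union> comp b \<union> {x, y}" "graph_cycle E vs" "4 \<le> length vs"
      "\<not> has_chord E vs"
      using glue_induced_paths[OF sym xs ws disj \<open>x \<noteq> y\<close> \<open>\<not> E x y\<close>] by blast
    moreover have "comp a \<union> comp b \<union> {x, y} \<subseteq> S"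
      using comp_sub[OF aC] comp_sub[OF bC] xy C by blast
    ultimately show False using chordal unfolding chordal_graph_def by (meson subset_trans)
  qed
  have a: "a \<in> comp a" "b \<notin> comp a" using disj by (auto simp: comp_def)
  \<comment> \<open>The separator \<open>C\<close> belongs to both sides: \<open>A\<close> is the
    component of \<open>a\<close> together with \<open>C\<close>, and \<open>B\<close> is everything
    outside that component.\<close>
  have AB: "(comp a \<union> C) - (S - comp a) = comp a" "(S - comp a) - (comp a \<union> C) = S - comp a - C"
    "(comp a \<union> C) \<inter> (S - comp a) = C" "(comp a \<union> C) \<union> (S - comp a) = S"
    using comp_sub[OF aC] C by auto
  show thesis
  proof (rule that[of "comp a \<union> C" "S - comp a"], unfold AB)
    show "a \<in> comp a" "b \<in> S - comp a - C" using a bC by auto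
    show "\<not> E u v" if "u \<in> comp a" "v \<in> S - comp a - C" for u v
      using that comp_step[of u a v] comp_sub[OF aC] by blast
    show "E u v" if "u \<in> C" "v \<in> C" "u \<noteq> v" for u v using clique that by blast
  qed simp
qed

section \<open>Bass-Serre trees\<close>

context group begin

lemma inv_mult_cancel:
  assumes "k \<in> carrier G" "h \<in> carrier G"
  shows "k \<otimes> (inv k \<otimes> h) = h" "inv k \<otimes> (k \<otimes> h) = h"
  using assms by (simp_all add: m_assoc[symmetric])

lemma l_coset_eq_iff:
  assumes H: "subgroup H G" and "g \<in> carrier G" "h \<in> carrier G"
  shows "g <# H = h <# H \<longleftrightarrow> inv g \<otimes> h \<in> H"
proof
  assume eq: "g <# H = h <# H"
  have "h \<otimes> \<one> \<in> h <# H" using subgroup.one_closed[OF H] unfolding l_coset_def by blast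
  then have "h \<in> g <# H" using eq assms by simp
  then obtain a where "a \<in> H" "h = g \<otimes> a" unfolding l_coset_def by blast
  then show "inv g \<otimes> h \<in> H"
    using assms subgroup.mem_carrier[OF H] by (simp add: m_assoc[symmetric])
next
  assume "inv g \<otimes> h \<in> H"
  moreover have "h = g \<otimes> (inv g \<otimes> h)" using assms by (simp add: m_assoc[symmetric])
  ultimately have "h \<in> g <# H" unfolding l_coset_def by blast
  then show "g <# H = h <# H" using assms l_repr_independence by blast
qed

end

text \<open>The set \<open>P\<close> collects the elements of \<open>K\<close> whose normal form in the amalgamated product
  \<open>A *\<^sub>C B\<close> does not start in \<open>B - C\<close>; it is the trace on \<open>K\<close> of a half-tree of the Bass-Serre tree.\<close>
locale amalgam = group G for G (structure) +
  fixes K A B C P :: "'a set"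
  assumes K: "subgroup K G" and A: "subgroup A G" and B: "subgroup B G"
    and AK: "A \<subseteq> K" and BK: "B \<subseteq> K" and CA: "C \<subseteq> A" and CB: "C \<subseteq> B"
    and C1: "\<one> \<in> C" and P1: "\<one> \<in> P"
    and PA: "\<And>g a. g \<in> K \<Longrightarrow> a \<in> A \<Longrightarrow> g \<otimes> a \<in> P \<longleftrightarrow> g \<in> P"
    and PB: "\<And>g b. g \<in> K \<Longrightarrow> b \<in> B \<Longrightarrow> g \<otimes> b \<in> P - C \<longleftrightarrow> g \<in> P - C"
    and gen: "\<And>Q. \<one> \<in> Q \<Longrightarrow> (\<And>g a. g \<in> Q \<Longrightarrow> g \<in> K \<Longrightarrow> a \<in> A \<union> B \<Longrightarrow> g \<otimes> a \<in> Q) \<Longrightarrow> K \<subseteq> Q"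
begin

text \<open>The flag keeps cosets of \<open>A\<close> and of \<open>B\<close> apart even if they
  coincide as sets. The action preserves it, which excludes inversions of edges.\<close>

definition vA :: "'a \<Rightarrow> 'a set \<times> bool" where "vA g = (g <# A, True)"
definition vB :: "'a \<Rightarrow> 'a set \<times> bool" where "vB g = (g <# B, False)"
definition V :: "('a set \<times> bool) set" where "V = vA ` K \<union> vB ` K"
definition adj :: "'a set \<times> bool \<Rightarrow> 'a set \<times> bool \<Rightarrow> bool" where
  "adj u v \<longleftrightarrow> (\<exists>g\<in>K. (u = vA g \<and> v = vB g) \<or> (u = vB g \<and> v = vA g))"
definition act :: "'a \<Rightarrow> 'a set \<times> bool \<Rightarrow> 'a set \<times> bool" where
  "act x v = (x <# fst v, snd v)"

lemma Kc: "g \<in> K \<Longrightarrow> g \<in> carrier G" using subgroup.mem_carrier[OF K] .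
lemma Km: "g \<in> K \<Longrightarrow> h \<in> K \<Longrightarrow> g \<otimes> h \<in> K" using subgroup.m_closed[OF K] .
lemma Ki: "g \<in> K \<Longrightarrow> inv g \<in> K" using subgroup.m_inv_closed[OF K] .

lemma vA_eq: "g \<in> K \<Longrightarrow> h \<in> K \<Longrightarrow> vA g = vA h \<longleftrightarrow> inv g \<otimes> h \<in> A"
  by (simp add: vA_def l_coset_eq_iff[OF A] Kc)
lemma vB_eq: "g \<in> K \<Longrightarrow> h \<in> K \<Longrightarrow> vB g = vB h \<longleftrightarrow> inv g \<otimes> h \<in> B"
  by (simp add: vB_def l_coset_eq_iff[OF B] Kc)
lemma vA_neq_vB [simp]: "vA g \<noteq> vB h" "vB h \<noteq> vA g" by (auto simp: vA_def vB_def)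

lemma vA_V [simp]: "g \<in> K \<Longrightarrow> vA g \<in> V" and vB_V [simp]: "g \<in> K \<Longrightarrow> vB g \<in> V"
  by (auto simp: V_def)

lemma act_vA: "x \<in> K \<Longrightarrow> g \<in> K \<Longrightarrow> act x (vA g) = vA (x \<otimes> g)"
  using subgroup.subset[OF A] by (simp add: act_def vA_def lcos_m_assoc Kc)
lemma act_vB: "x \<in> K \<Longrightarrow> g \<in> K \<Longrightarrow> act x (vB g) = vB (x \<otimes> g)"
  using subgroup.subset[OF B] by (simp add: act_def vB_def lcos_m_assoc Kc)

text \<open>The translate by \<open>g\<close> of the half-tree described by \<open>P\<close>. For
  cosets of \<open>B\<close> the elements of \<open>C\<close> are removed, because they represent
  \<open>vB \<one>\<close>, the far end of the base edge. \<open>PA\<close> and \<open>PB\<close>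
  make membership independent of the representative.\<close>

definition base_half :: "'a \<Rightarrow> ('a set \<times> bool) set" where
  "base_half g = {vA h | h. h \<in> K \<and> inv g \<otimes> h \<in> P} \<union> {vB h | h. h \<in> K \<and> inv g \<otimes> h \<in> P - C}"

lemma vA_base_half: 
  assumes "g \<in> K" "h \<in> K" shows "vA h \<in> base_half g \<longleftrightarrow> inv g \<otimes> h \<in> P"
proof -
  have "inv g \<otimes> h \<in> P" if "vA h = vA k" "k \<in> K" "inv g \<otimes> k \<in> P" for k
  proof -
    have "inv k \<otimes> h \<in> A" using vA_eq[of k h] that assms by simp
    moreover have "(inv g \<otimes> k) \<otimes> (inv k \<otimes> h) = inv g \<otimes> h"
      using assms that Kc by (simp add: m_assoc inv_mult_cancel)
    ultimately show ?thesis using PA[of "inv g \<otimes> k" "inv k \<otimes> h"] that assms Km Ki by simp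
  qed
  then show ?thesis using assms by (auto simp: base_half_def)
qed

lemma vB_base_half: 
  assumes "g \<in> K" "h \<in> K" shows "vB h \<in> base_half g \<longleftrightarrow> inv g \<otimes> h \<in> P - C"
proof -
  have "inv g \<otimes> h \<in> P - C" if "vB h = vB k" "k \<in> K" "inv g \<otimes> k \<in> P - C" for k
  proof -
    have "inv k \<otimes> h \<in> B" using vB_eq[of k h] that assms by simp
    moreover have "(inv g \<otimes> k) \<otimes> (inv k \<otimes> h) = inv g \<otimes> h"
      using assms that Kc by (simp add: m_assoc inv_mult_cancel)
    ultimately show ?thesis using PB[of "inv g \<otimes> k" "inv k \<otimes> h"] that assms Km Ki by simp
  qed
  moreover have "vB h \<in> base_half g \<longleftrightarrow> (\<exists>k\<in>K. vB h = vB k \<and> inv g \<otimes> k \<in> P - C)"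
    by (auto simp: base_half_def)
  ultimately show ?thesis using assms by blast
qed

text \<open>The edge given by \<open>h\<close> leaves the set only if
  \<open>inv g \<otimes> h\<close> is in \<open>C\<close>, and then \<open>h\<close> and
  \<open>g\<close> have the same cosets of \<open>A\<close> and of \<open>B\<close>.\<close>

lemma half_base_half:
  assumes g: "g \<in> K" shows "half_tree V adj (vA g) (vB g) (base_half g)"
proof -
  have sub: "base_half g \<subseteq> V" by (auto simp: base_half_def V_def)
  have "u = vA g \<and> v = vB g" if uv: "adj u v" "u \<in> base_half g" "v \<notin> base_half g" for u v
  proof -
    obtain h where h: "h \<in> K" "(u = vA h \<and> v = vB h) \<or> (u = vB h \<and> v = vA h)"
      using uv unfolding adj_def by blast
    then have c: "inv g \<otimes> h \<in> C" and u: "u = vA h" "v = vB h"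
      using uv vA_base_half[OF g] vB_base_half[OF g] by auto
    then show ?thesis using vA_eq[OF g h(1)] vB_eq[OF g h(1)] CA CB by auto
  qed
  then show ?thesis
    using sub g vA_base_half[OF g g] vB_base_half[OF g g] Kc C1 P1
    unfolding half_tree_def by (auto simp: V_def adj_def)
qed

sublocale tree V adj
proof
  fix u v p q :: "'a set \<times> bool"
  show adjV: "u \<in> V \<and> v \<in> V" if "adj u v" for u v using that by (auto simp: adj_def)
  show sym: "adj v u" if "adj u v" for u v using that by (auto simp: adj_def)
  have 1: "\<one> \<in> K" using subgroup.one_closed[OF K] .
  let ?Q = "{g \<in> K. adj\<^sup>*\<^sup>* (vA \<one>) (vA g)}"
  have ab: "adj (vA g) (vB g)" "adj (vB g) (vA g)" if "g \<in> K" for g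
    using that by (auto simp: adj_def)
  have "K \<subseteq> ?Q"
  proof (rule gen)
    show "\<one> \<in> ?Q" using 1 by simp
    fix g a assume g: "g \<in> ?Q" "g \<in> K" and a: "a \<in> A \<union> B"
    then have ga: "g \<otimes> a \<in> K" using Km AK BK by blast
    have eq: "inv g \<otimes> (g \<otimes> a) = a"
      using inv_mult_cancel(2)[of g a] g a Kc AK BK by blast
    from a show "g \<otimes> a \<in> ?Q"
    proof
      assume "a \<in> A"
      then have "vA g = vA (g \<otimes> a)" using vA_eq[OF g(2) ga] eq by simp
      then show ?thesis using g ga by simp
    next
      assume "a \<in> B"
      then have "vB g = vB (g \<otimes> a)" using vB_eq[OF g(2) ga] eq by simp
      \<comment> \<open>The vertices \<open>vA g\<close> and \<open>vA (g \<otimes> a)\<close> have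
        the common neighbour \<open>vB g\<close>.\<close>
      then have "adj\<^sup>*\<^sup>* (vA g) (vA (g \<otimes> a))" using ab[OF g(2)] ab[OF ga]
        by (metis converse_rtranclp_into_rtranclp rtranclp.rtrancl_refl)
      then show ?thesis using g ga by (auto intro: rtranclp_trans)
    qed
  qed
  then have A1: "adj\<^sup>*\<^sup>* (vA \<one>) (vA g)" if "g \<in> K" for g using that by blast
  then have B1: "adj\<^sup>*\<^sup>* (vA \<one>) (vB g)" if "g \<in> K" for g
    using that ab by (meson rtranclp.rtrancl_into_rtrancl)
  have reach: "adj\<^sup>*\<^sup>* (vA \<one>) w" if "w \<in> V" for w using that A1 B1 by (auto simp: V_def)
  have "symp adj" using sym by (auto intro: sympI)
  then have "adj\<^sup>*\<^sup>* w (vA \<one>)" if "w \<in> V" for w using reach[OF that] by (meson sympD symp_rtranclp)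
  then show "adj\<^sup>*\<^sup>* u v" if "u \<in> V" "v \<in> V" using that reach by (meson rtranclp_trans)
  show "\<exists>H. half_tree V adj p q H" if pq: "adj p q"
  proof -
    obtain g where g: "g \<in> K" "(p = vA g \<and> q = vB g) \<or> (p = vB g \<and> q = vA g)"
      using pq unfolding adj_def by blast
    have H: "half_tree V adj (vA g) (vB g) (base_half g)" using half_base_half g by blast
    then have "half_tree V adj (vB g) (vA g) (V - base_half g)"
      using sym adjV unfolding half_tree_def by blast
    then show ?thesis using g H by blast
  qed
qed

section \<open>Fixed vertices and vertex stabilisers\<close>

lemma act_involution:
  assumes x: "x \<in> K" "x \<otimes> x = \<one>" shows "involution (act x)"
proof -
  have *: "x \<otimes> (x \<otimes> g) = g" if "g \<in> K" for g
    using x that Kc by (simp add: m_assoc[symmetric])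
  have "act x v \<in> V \<and> act x (act x v) = v" if "v \<in> V" for v
    using that x Km * by (auto simp: V_def act_vA act_vB)
  moreover have "adj (act x u) (act x v) \<and> act x u \<noteq> v" if "adj u v" for u v
    using that x Km unfolding adj_def by (auto simp: act_vA act_vB)
  ultimately show ?thesis by (simp add: involution_def)
qed

lemma Fix_vA: 
  assumes "x \<in> K" "g \<in> K" shows "vA g \<in> Fix (act x) \<longleftrightarrow> inv g \<otimes> x \<otimes> g \<in> A"
proof -
  have "vA g \<in> Fix (act x) \<longleftrightarrow> vA g = vA (x \<otimes> g)"
    using assms by (auto simp: Fix_def act_vA)
  then show ?thesis using assms vA_eq Km Kc by (simp add: m_assoc)
qed

lemma Fix_vB: 
  assumes "x \<in> K" "g \<in> K" shows "vB g \<in> Fix (act x) \<longleftrightarrow> inv g \<otimes> x \<otimes> g \<in> B"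
proof -
  have "vB g \<in> Fix (act x) \<longleftrightarrow> vB g = vB (x \<otimes> g)"
    using assms by (auto simp: Fix_def act_vB)
  then show ?thesis using assms vB_eq Km Kc by (simp add: m_assoc)
qed

text \<open>Vertex stabilisers are conjugates of \<open>A\<close> or of \<open>B\<close>;
  \<open>g\<close> is a representative of the coset \<open>v\<close>.\<close>

lemma common_Fix:
  assumes "v \<in> V"
  shows "\<exists>H\<in>{A, B}. \<exists>g\<in>K. \<forall>x\<in>K. v \<in> Fix (act x) \<longrightarrow> inv g \<otimes> x \<otimes> g \<in> H"
proof -
  from assms consider g where "g \<in> K" "v = vA g" | g where "g \<in> K" "v = vB g"
    unfolding V_def by blast
  then show ?thesis
  proof cases
    case 1 then show ?thesis using Fix_vA[OF _ 1(1)] by (intro bexI[of _ A] bexI[of _ g]) auto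
  next
    case 2 then show ?thesis using Fix_vB[OF _ 2(1)] by (intro bexI[of _ B] bexI[of _ g]) auto
  qed
qed

lemma act_pow:
  assumes x: "x \<in> K" "y \<in> K" and v: "v \<in> V" and one: "(x \<otimes> y) [^] (n::nat) = \<one>"
  shows "((act x \<circ> act y) ^^ n) v = v"
proof -
  have pK: "(x \<otimes> y) [^] k \<in> K" for k :: nat
    by (induction k) (use x Km subgroup.one_closed[OF K] in auto)
  have xc: "x \<otimes> y \<in> K" using x Km by simp
  have comm: "(x \<otimes> y) \<otimes> (x \<otimes> y) [^] k = (x \<otimes> y) [^] Suc k" for k :: nat
    using nat_pow_comm[OF Kc[OF xc], of 1 k] xc Kc by simp
  have eA: "((act x \<circ> act y) ^^ k) (vA g) = vA ((x \<otimes> y) [^] k \<otimes> g)" if "g \<in> K" for g k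
  proof (induction k)
    case (Suc k)
    then show ?case
      using that x pK[of k] Km Kc comm[of k] by (simp add: act_vA m_assoc[symmetric])
  qed (use that Kc in simp)
  have eB: "((act x \<circ> act y) ^^ k) (vB g) = vB ((x \<otimes> y) [^] k \<otimes> g)" if "g \<in> K" for g k
  proof (induction k)
    case (Suc k)
    then show ?case
      using that x pK[of k] Km Kc comm[of k] by (simp add: act_vB m_assoc[symmetric])
  qed (use that Kc in simp)
  show ?thesis using v eA[of _ n] eB[of _ n] one Kc by (auto simp: V_def)
qed

lemma V_nonempty: "V \<noteq> {}"
  using subgroup.one_closed[OF K] by (auto simp: V_def)

lemma torsion_meet:
  assumes "x \<in> K" "y \<in> K" "x \<otimes> x = \<one>" "y \<otimes> y = \<one>" "(x \<otimes> y) [^] (n::nat) = \<one>" "n > 0"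
  shows "Fix (act x) \<inter> Fix (act y) \<noteq> {}"
proof (rule Fix_meet[of _ _ n])
  show "involution (act x)" "involution (act y)" using assms act_involution by simp_all
  show "((act x \<circ> act y) ^^ n) v = v" if "v \<in> V" for v using assms(1,2) that assms(5) by (rule act_pow)
qed (use assms V_nonempty in simp_all)

text \<open>Products of finite order make the fixed trees meet in pairs, and Helly's property then
  yields a vertex fixed by all of \<open>X\<close>, even if \<open>X\<close> generates an infinite
  group.\<close>

lemma fix_common_conjugate:
  assumes "finite X" "X \<subseteq> K"
    and sq: "\<And>x. x \<in> X \<Longrightarrow> x \<otimes> x = \<one>"
    and tor: "\<And>x y. x \<in> X \<Longrightarrow> y \<in> X \<Longrightarrow> \<exists>n::nat. n > 0 \<and> (x \<otimes> y) [^] n = \<one>"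
  shows "\<exists>H\<in>{A, B}. \<exists>g\<in>K. \<forall>x\<in>X. inv g \<otimes> x \<otimes> g \<in> H"
proof (cases "X = {}")
  case True then show ?thesis using subgroup.one_closed[OF K] by auto
next
  case False
  have "(\<Inter>x\<in>X. Fix (act x)) \<noteq> {}"
  proof (rule helly[OF \<open>finite X\<close> False])
    show "convex (Fix (act x))" if "x \<in> X" for x
      using that \<open>X \<subseteq> K\<close> by (intro convex_Fix act_involution sq) auto
    show "Fix (act x) \<inter> Fix (act y) \<noteq> {}" if xy: "x \<in> X" "y \<in> X" for x y
    proof -
      obtain n :: nat where "n > 0" "(x \<otimes> y) [^] n = \<one>" using tor[OF xy] by blast
      moreover have "x \<in> K" "y \<in> K" using xy \<open>X \<subseteq> K\<close> by auto
      ultimately show ?thesis using torsion_meet[of x y n] sq[OF xy(1)] sq[OF xy(2)] by simp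
    qed
  qed
  then obtain v where v: "\<And>x. x \<in> X \<Longrightarrow> v \<in> Fix (act x)" by blast
  then have "v \<in> V" using False by (auto simp: Fix_def)
  from common_Fix[OF this] obtain H g where Hg: "H \<in> {A, B}" "g \<in> K"
    "\<forall>x\<in>K. v \<in> Fix (act x) \<longrightarrow> inv g \<otimes> x \<otimes> g \<in> H" by blast
  then have "\<forall>x\<in>X. inv g \<otimes> x \<otimes> g \<in> H" using v \<open>X \<subseteq> K\<close> by auto
  then show ?thesis using Hg(1,2) by blast
qed

text \<open>A common fixed vertex gives the first alternative. In the second, the common edge has
  ends \<open>vA g\<close> and \<open>vB g\<close> for one and the same \<open>g\<close>.\<close>

lemma cycle_conjugate:
  fixes t :: "nat \<Rightarrow> 'a"
  assumes "n > 0" and tK: "\<And>k. t k \<in> K" and sq: "\<And>k. t k \<otimes> t k = \<one>"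
    and per: "\<And>k. t (k + n) = t k"
    and tor: "\<And>k. \<exists>r::nat. r > 0 \<and> (t k \<otimes> t (Suc k)) [^] r = \<one>"
  shows "(\<exists>H\<in>{A, B}. \<exists>g\<in>K. \<forall>k. inv g \<otimes> t k \<otimes> g \<in> H) \<or>
    (\<exists>k l. Suc k < l \<and> Suc l < k + n \<and>
       (\<exists>g\<in>K. inv g \<otimes> t k \<otimes> g \<in> A \<inter> B \<and> inv g \<otimes> t l \<otimes> g \<in> A \<inter> B))"
proof -
  let ?T = "\<lambda>k. Fix (act (t k))"
  have "?T k \<inter> ?T (Suc k) \<noteq> {}" for k
  proof -
    obtain r :: nat where "r > 0" "(t k \<otimes> t (Suc k)) [^] r = \<one>" using tor by blast
    then show ?thesis using torsion_meet[of "t k" "t (Suc k)" r] tK sq by simp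
  qed
  moreover have "convex (?T k)" for k by (intro convex_Fix act_involution tK sq)
  ultimately have "(\<Inter>k. ?T k) \<noteq> {} \<or>
    (\<exists>k l p q. Suc k < l \<and> Suc l < k + n \<and> adj p q \<and> p \<in> ?T k \<and> q \<in> ?T k \<and> p \<in> ?T l \<and> q \<in> ?T l)"
    by (intro cycle_cases) (simp_all add: \<open>n > 0\<close> per)
  then show ?thesis
  proof (elim disjE)
    assume "(\<Inter>k. ?T k) \<noteq> {}"
    then obtain v where "v \<in> (\<Inter>k. ?T k)" by (rule ex_in_conv[THEN iffD2, THEN exE])
    then have 1: "v \<in> ?T k" for k by simp
    then have "v \<in> V" unfolding Fix_def by blast
    from common_Fix[OF this] obtain H g where Hg: "H \<in> {A, B}" "g \<in> K"
      "\<forall>x\<in>K. v \<in> Fix (act x) \<longrightarrow> inv g \<otimes> x \<otimes> g \<in> H" by blast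
    then have "\<forall>k. inv g \<otimes> t k \<otimes> g \<in> H" using 1 tK by auto
    then show ?thesis using Hg(1,2) by blast
  next
    assume "\<exists>k l p q. Suc k < l \<and> Suc l < k + n \<and> adj p q \<and>
      p \<in> ?T k \<and> q \<in> ?T k \<and> p \<in> ?T l \<and> q \<in> ?T l"
    then obtain k l p q where 2: "Suc k < l" "Suc l < k + n" "adj p q"
      "p \<in> ?T k" "q \<in> ?T k" "p \<in> ?T l" "q \<in> ?T l" by (elim exE conjE)
    obtain g where g: "g \<in> K" "{p, q} = {vA g, vB g}" using 2(3) unfolding adj_def by blast
    have "{p, q} \<subseteq> ?T k" "{p, q} \<subseteq> ?T l" using 2 by simp_all
    then have "{vA g, vB g} \<subseteq> ?T k" "{vA g, vB g} \<subseteq> ?T l" unfolding g(2) .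
    then have "inv g \<otimes> t k \<otimes> g \<in> A \<inter> B" "inv g \<otimes> t l \<otimes> g \<in> A \<inter> B"
      using Fix_vA[OF tK g(1)] Fix_vB[OF tK g(1)] by auto
    then show ?thesis using 2 g by blast
  qed
qed

text \<open>The fixed trees of \<open>a\<close> and \<open>b\<close> lie on different sides of the base edge.\<close>
lemma no_common_conjugate:
  assumes a: "a \<in> A - B" "a \<otimes> a = \<one>" and b: "b \<in> B - A" "b \<otimes> b = \<one>"
    and H: "H \<in> {A, B}" and g: "g \<in> K"
  shows "\<not> (inv g \<otimes> a \<otimes> g \<in> H \<and> inv g \<otimes> b \<otimes> g \<in> H)"
proof
  assume gH: "inv g \<otimes> a \<otimes> g \<in> H \<and> inv g \<otimes> b \<otimes> g \<in> H"
  have aK: "a \<in> K" and bK: "b \<in> K" using a b AK BK by auto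
  have 1: "\<one> \<in> K" using subgroup.one_closed[OF K] .
  obtain v where v: "v \<in> Fix (act a)" "v \<in> Fix (act b)"
  proof (cases "H = A")
    case True
    then show ?thesis using that[of "vA g"] gH Fix_vA[OF aK g] Fix_vA[OF bK g] by simp
  next
    case False
    then show ?thesis using that[of "vB g"] H gH Fix_vB[OF aK g] Fix_vB[OF bK g] by simp
  qed
  have F: "vA \<one> \<in> Fix (act a)" "vB \<one> \<notin> Fix (act a)" "vA \<one> \<notin> Fix (act b)" "vB \<one> \<in> Fix (act b)"
    using Fix_vA[OF aK 1] Fix_vB[OF aK 1] Fix_vA[OF bK 1] Fix_vB[OF bK 1] a b aK bK Kc by auto
  have Ha: "half (vA \<one>) (vB \<one>) (base_half \<one>)" using half_base_half[OF 1] .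
  note ends = half_ends[OF Ha]
  have ca: "convex (Fix (act a))" and cb: "convex (Fix (act b))"
    by (intro convex_Fix act_involution aK bK a(2) b(2))+
  show False
  \<comment> \<open>If \<open>v\<close> is on the side of \<open>vA \<one>\<close>, then the fixed
    tree of \<open>b\<close> straddles the base edge and would contain \<open>vA \<one>\<close>,
    which \<open>b\<close> moves; the other case is symmetric.\<close>
  proof (cases "v \<in> base_half \<one>")
    case True
    then show False using convexD[OF cb Ha v(2) True F(4)] ends F by blast
  next
    case False
    then show False using convexD[OF ca Ha F(1) _ v(1) False] ends F by blast
  qed
qed

end

section \<open>Coxeter systems\<close>

lemma (in group) conjugate_pow:
  assumes "g \<in> carrier G" "x \<in> carrier G"
  shows "(inv g \<otimes> x \<otimes> g) [^] (n::nat) = inv g \<otimes> x [^] n \<otimes> g"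
  using assms by (induction n) (simp_all add: m_assoc inv_mult_cancel)

lemma (in group) conjugate_mult:
  assumes "g \<in> carrier G" "x \<in> carrier G" "y \<in> carrier G"
  shows "(inv g \<otimes> x \<otimes> g) \<otimes> (inv g \<otimes> y \<otimes> g) = inv g \<otimes> (x \<otimes> y) \<otimes> g"
  using assms by (simp add: m_assoc inv_mult_cancel)

lemma concat_replicate_lists: "s \<in> A \<Longrightarrow> t \<in> A \<Longrightarrow> concat (replicate k [s, t]) \<in> lists A"
  by (induction k) auto

lemma concat_replicate_Suc: "concat (replicate (Suc k) xs) = concat (replicate k xs) @ xs"
proof -
  have "replicate (Suc k) xs = replicate k xs @ [xs]"
    by (simp only: replicate_Suc replicate_append_same)
  then show ?thesis by (simp only: concat_append concat.simps append_Nil2)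
qed

locale coxeter =
  fixes G :: "('a, 'b) monoid_scheme" (structure) and S :: "'a set" and m :: "'a \<Rightarrow> 'a \<Rightarrow> enat"
  assumes system: "coxeter_system G S m"
begin

sublocale group G using system by (simp add: coxeter_system_def)

abbreviation ev where "ev \<equiv> word_eval G"

text \<open>The visual subgroup on \<open>I\<close>, for \<open>I\<close> contained in
  \<open>S\<close>; words without inverses suffice because generators are involutions.\<close>

definition parabolic :: "'a set \<Rightarrow> 'a set" where "parabolic I = ev ` lists I"

lemma S_carrier: "S \<subseteq> carrier G" using system by (simp add: coxeter_system_def)
lemma S_closed [simp]: "s \<in> S \<Longrightarrow> s \<in> carrier G" using S_carrier by blast

lemma word_closed: "w \<in> lists S \<Longrightarrow> w \<in> lists (carrier G)"
  using S_carrier by auto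

lemma ev_Nil [simp]: "ev [] = \<one>" by (simp add: word_eval_def)
lemma ev_Cons [simp]: "ev (s # w) = s \<otimes> ev w" by (simp add: word_eval_def)
lemma ev_closed: "w \<in> lists (carrier G) \<Longrightarrow> ev w \<in> carrier G" by (induction w) auto
lemma ev_S_closed [simp]: "w \<in> lists S \<Longrightarrow> ev w \<in> carrier G" by (intro ev_closed word_closed)
lemma ev_append: "u \<in> lists (carrier G) \<Longrightarrow> v \<in> lists (carrier G) \<Longrightarrow> ev (u @ v) = ev u \<otimes> ev v"
  by (induction u) (auto simp: m_assoc ev_closed)

lemma relator_lists: "r \<in> coxeter_relators S m \<Longrightarrow> r \<in> lists S"
  unfolding coxeter_relators_def mem_Collect_eq
  by (elim exE conjE, hypsubst, rule concat_replicate_lists)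

lemma ev_relator: "r \<in> coxeter_relators S m \<Longrightarrow> ev r = \<one>"
proof -
  assume r: "r \<in> coxeter_relators S m"
  then have "([] @ r @ [], [] @ []) \<in> relator_step (coxeter_relators S m)"
    unfolding relator_step_def by blast
  then have "(r, []) \<in> presentation_equiv (coxeter_relators S m)"
    unfolding presentation_equiv_def by auto
  then show "ev r = \<one>" using system relator_lists[OF r] unfolding coxeter_system_def by blast
qed

lemma square_relator: "s \<in> S \<Longrightarrow> [s, s] \<in> coxeter_relators S m"
proof -
  assume s: "s \<in> S"
  then have "m s s = enat 1" using system by (simp add: coxeter_system_def coxeter_matrix_def one_enat_def)
  moreover have "[s, s] = concat (replicate 1 [s, s])" by simp
  ultimately show ?thesis using s unfolding coxeter_relators_def by blast
qed

lemma square [simp]: "s \<in> S \<Longrightarrow> s \<otimes> s = \<one>"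
  using ev_relator[OF square_relator] by simp

lemma inv_S: "s \<in> S \<Longrightarrow> inv s = s" by (simp add: inv_equality)

lemma ev_rev: "w \<in> lists S \<Longrightarrow> ev (rev w) = inv (ev w)"
proof (induction w)
  case (Cons s w)
  then have "ev (rev w @ [s]) = ev (rev w) \<otimes> ev [s]"
    by (intro ev_append) (use S_carrier in auto)
  then show ?case using Cons by (simp add: inv_mult_group inv_S)
qed simp

lemma ev_pow: "s \<in> S \<Longrightarrow> t \<in> S \<Longrightarrow> ev (concat (replicate k [s, t])) = (s \<otimes> t) [^] k"
proof (induction k)
  case (Suc k)
  then show ?case using nat_pow_Suc2[of "s \<otimes> t" k] by (simp add: m_assoc)
qed simp

lemma torsion:
  assumes "s \<in> S" "t \<in> S" "m s t \<noteq> \<infinity>" shows "\<exists>r::nat. r > 0 \<and> (s \<otimes> t) [^] r = \<one>"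
proof -
  obtain k where k: "m s t = enat k" using assms by auto
  then have "concat (replicate k [s, t]) \<in> coxeter_relators S m"
    unfolding coxeter_relators_def using assms by blast
  then have "(s \<otimes> t) [^] k = \<one>" using ev_relator ev_pow assms by metis
  moreover have "1 \<le> m s t"
  proof (cases "s = t")
    case True then show ?thesis using assms system by (simp add: coxeter_system_def coxeter_matrix_def)
  next
    case False
    then have "2 \<le> m s t" using assms system by (simp add: coxeter_system_def coxeter_matrix_def)
    moreover have "(1::enat) \<le> 2" by simp
    ultimately show ?thesis by (rule order_trans[rotated])
  qed
  then have "k > 0" using k by (cases k) (auto simp: one_enat_def zero_enat_def)
  ultimately show ?thesis by blast
qed

text \<open>All relators have even length, so the parity of the length of a word is invariant under
  the presentation.\<close>

lemma S_neq_one: "s \<in> S \<Longrightarrow> s \<noteq> \<one>"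
proof
  assume s: "s \<in> S" "s = \<one>"
  have "(u, v) \<in> presentation_equiv (coxeter_relators S m) \<Longrightarrow> even (length u) = even (length v)" for u v
    unfolding presentation_equiv_def
  proof (induction rule: rtrancl_induct)
    case (step y z)
    have "even (length r)" if "r \<in> coxeter_relators S m" for r
      using that by (auto simp: coxeter_relators_def length_concat sum_list_replicate)
    then show ?case using step by (auto simp: relator_step_def)
  qed simp
  moreover have "([s], []) \<in> presentation_equiv (coxeter_relators S m)"
    using s system unfolding coxeter_system_def by (metis Cons_in_lists_iff ev_Cons ev_Nil lists.Nil r_one S_closed)
  ultimately show False by fastforce
qed

section \<open>Cochains on the Cayley graph with values in Z/2\<close>

text \<open>The sum of a cochain along the path in the Cayley graph that starts at \<open>g\<close>
  and reads the word; \<open>f g s\<close> is the value on the edge from \<open>g\<close> to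
  \<open>g \<otimes> s\<close>.\<close>

primrec crossings :: "('a \<Rightarrow> 'a \<Rightarrow> bool) \<Rightarrow> 'a \<Rightarrow> 'a list \<Rightarrow> nat" where
  "crossings f g [] = 0"
| "crossings f g (s # w) = of_bool (f g s) + crossings f (g \<otimes> s) w"

lemma crossings_append:
  "g \<in> carrier G \<Longrightarrow> u \<in> lists (carrier G) \<Longrightarrow>
    crossings f g (u @ v) = crossings f g u + crossings f (g \<otimes> ev u) v"
  by (induction u arbitrary: g) (auto simp: m_assoc ev_closed)

text \<open>A 1-cochain on the Cayley graph with values in Z/2 that vanishes on the relators
  is a coboundary.\<close>
lemma potential:
  assumes f: "\<And>r g. r \<in> coxeter_relators S m \<Longrightarrow> g \<in> carrier G \<Longrightarrow> even (crossings f g r)"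
  obtains F where "\<not> F \<one>" "\<And>g s. g \<in> carrier G \<Longrightarrow> s \<in> S \<Longrightarrow> F (g \<otimes> s) = (F g \<noteq> f g s)"
proof -
  have ins: "even (crossings f \<one> (a @ r @ b)) = even (crossings f \<one> (a @ b))"
    if "a \<in> lists S" "r \<in> coxeter_relators S m" for a r b
  proof -
    have "crossings f \<one> (a @ r @ b) = crossings f \<one> a + (crossings f (ev a) r + crossings f (ev a) b)"
      using that relator_lists[OF that(2)] ev_relator[OF that(2)] word_closed by (simp add: crossings_append)
    moreover have "crossings f \<one> (a @ b) = crossings f \<one> a + crossings f (ev a) b"
      using that word_closed by (simp add: crossings_append)
    ultimately show ?thesis using f[OF that(2), of "ev a"] that by simp
  qed
  have equiv: "v \<in> lists S \<and> even (crossings f \<one> u) = even (crossings f \<one> v)"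
    if "(u, v) \<in> presentation_equiv (coxeter_relators S m)" "u \<in> lists S" for u v
    using that unfolding presentation_equiv_def
  proof (induction rule: rtrancl_induct)
    case (step y z)
    have y: "y \<in> lists S" "even (crossings f \<one> u) = even (crossings f \<one> y)" using step by auto
    from step(2) obtain a r b where r: "r \<in> coxeter_relators S m"
      and yz: "(y = a @ r @ b \<and> z = a @ b) \<or> (y = a @ b \<and> z = a @ r @ b)"
      unfolding relator_step_def by blast
    have "a \<in> lists S" "b \<in> lists S" using y(1) yz by auto
    then show ?case using ins[of a r b] relator_lists[OF r] r y(2) yz by auto
  qed simp
  have null: "even (crossings f \<one> (u @ rev v))" if "u \<in> lists S" "v \<in> lists S" "ev u = ev v" for u v
  proof -
    have uv: "u @ rev v \<in> lists S" using that by auto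
    have "ev (u @ rev v) = ev u \<otimes> ev (rev v)"
      by (intro ev_append word_closed) (use that in auto)
    then have "ev (u @ rev v) = \<one>" using that ev_rev by simp
    then have "(u @ rev v, []) \<in> presentation_equiv (coxeter_relators S m)"
      using system uv unfolding coxeter_system_def by blast
    then show ?thesis using equiv uv by fastforce
  qed
  \<comment> \<open>Both words are closed up by the same return path \<open>rev v\<close>, whose
    contribution cancels.\<close>
  have wd: "even (crossings f \<one> u) = even (crossings f \<one> v)"
    if "u \<in> lists S" "v \<in> lists S" "ev u = ev v" for u v
    using null[OF that] null[of v v] that word_closed by (auto simp: crossings_append)
  define word where "word g = (SOME w. w \<in> lists S \<and> ev w = g)" for g
  define F where "F g \<longleftrightarrow> odd (crossings f \<one> (word g))" for g
  have word: "word g \<in> lists S \<and> ev (word g) = g" if "g \<in> carrier G" for g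
  proof -
    have "\<exists>w. w \<in> lists S \<and> ev w = g" using system that unfolding coxeter_system_def by blast
    then show ?thesis unfolding word_def by (rule someI_ex)
  qed
  have F: "F (ev w) = odd (crossings f \<one> w)" if "w \<in> lists S" for w
    using word[of "ev w"] wd[of "word (ev w)" w] that unfolding F_def by simp
  show thesis
  proof (rule that)
    show "\<not> F \<one>" using F[of "[]"] by simp
    fix g s assume gs: "g \<in> carrier G" "s \<in> S"
    have w: "word g \<in> lists S" "ev (word g) = g" using word gs by auto
    have "ev (word g @ [s]) = g \<otimes> s" using w gs word_closed by (simp add: ev_append)
    then have "F (g \<otimes> s) = odd (crossings f \<one> (word g @ [s]))" using F[of "word g @ [s]"] w gs by simp
    also have "\<dots> = (odd (crossings f \<one> (word g)) \<noteq> f g s)"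
      using w gs word_closed by (simp add: crossings_append)
    finally show "F (g \<otimes> s) = (F g \<noteq> f g s)" unfolding F_def by simp
  qed
qed

text \<open>Conjugation by \<open>s\<close> inverts \<open>s \<otimes> t\<close>, and hence its
  powers.\<close>

lemma dihedral:
  assumes "s \<in> S" "t \<in> S" shows "(s \<otimes> t) [^] (j::nat) \<otimes> s \<otimes> (s \<otimes> t) [^] j = s"
proof (induction j)
  case (Suc j)
  let ?p = "(s \<otimes> t) [^] j"
  have c: "s \<in> carrier G" "t \<in> carrier G" "?p \<in> carrier G" using assms by auto
  have "(s \<otimes> t) [^] Suc j \<otimes> s \<otimes> (s \<otimes> t) [^] Suc j = (?p \<otimes> (s \<otimes> t)) \<otimes> s \<otimes> ((s \<otimes> t) \<otimes> ?p)"
    using c by (simp only: nat_pow_Suc nat_pow_Suc2[of "s \<otimes> t", symmetric] m_closed)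
  also have "\<dots> = ?p \<otimes> (s \<otimes> (t \<otimes> ((s \<otimes> s) \<otimes> (t \<otimes> ?p))))" using c by (simp only: m_assoc m_closed)
  also have "\<dots> = ?p \<otimes> (s \<otimes> ((t \<otimes> t) \<otimes> ?p))" using c assms(1) by (simp add: m_assoc)
  also have "\<dots> = ?p \<otimes> s \<otimes> ?p" using c assms(2) by (simp add: m_assoc)
  finally show ?case using Suc by simp
qed (use assms in simp)

text \<open>The classical reflection cocycle: \<open>F g\<close> is the parity of the number of
  times that \<open>x\<close> occurs among the reflections read along a word for \<open>g\<close>.
  Along a relator each reflection is read an even number of times.\<close>

lemma reflection_parity:
  obtains F where "\<not> F \<one>"
    "\<And>g s. g \<in> carrier G \<Longrightarrow> s \<in> S \<Longrightarrow> F (g \<otimes> s) = (F g \<noteq> (g \<otimes> s \<otimes> inv g = x))"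
proof (rule potential[of "\<lambda>g s. g \<otimes> s \<otimes> inv g = x"])
  let ?f = "\<lambda>g s. g \<otimes> s \<otimes> inv g = x"
  fix r g assume r: "r \<in> coxeter_relators S m" and g: "g \<in> carrier G"
  obtain s t k where st: "s \<in> S" "t \<in> S" and k: "m s t = enat k" and r': "r = concat (replicate k [s, t])"
    using r unfolding coxeter_relators_def by blast
  \<comment> \<open>Indicates whether \<open>x\<close> is the reflection read at position
    \<open>i\<close> of the alternating word in \<open>s\<close> and \<open>t\<close> that starts at
    \<open>g\<close>.\<close>
  define c where "c i = (of_bool (g \<otimes> ((s \<otimes> t) [^] (i::nat) \<otimes> s) \<otimes> inv g = x) :: nat)" for i
  have cl: "s \<in> carrier G" "t \<in> carrier G" "(s \<otimes> t) [^] (i::nat) \<in> carrier G" for i using st by auto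
  have cnt: "crossings ?f g (concat (replicate j [s, t])) = (\<Sum>i<2 * j. c i)" for j
  proof (induction j)
    case (Suc j)
    let ?p = "(s \<otimes> t) [^] j"
    have sp: "s \<otimes> inv ?p = ?p \<otimes> s"
    proof -
      have "(?p \<otimes> s \<otimes> ?p) \<otimes> inv ?p = ?p \<otimes> s" using cl by (simp add: m_assoc)
      then show ?thesis using dihedral[OF st, of j] by simp
    qed
    have comm: "t \<otimes> (?p \<otimes> s) = s \<otimes> (?p \<otimes> (s \<otimes> (t \<otimes> s)))"
    proof -
      have "(s \<otimes> t) \<otimes> ?p = ?p \<otimes> (s \<otimes> t)"
        using cl nat_pow_Suc2[of "s \<otimes> t" j] by simp
      then have "s \<otimes> ((s \<otimes> t) \<otimes> ?p) \<otimes> s = s \<otimes> (?p \<otimes> (s \<otimes> t)) \<otimes> s" by simp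
      moreover have "s \<otimes> ((s \<otimes> t) \<otimes> ?p) \<otimes> s = (s \<otimes> s) \<otimes> (t \<otimes> (?p \<otimes> s))" using cl by (simp only: m_assoc m_closed)
      ultimately show ?thesis using cl st by (simp add: m_assoc)
    qed
    have e1: "(g \<otimes> ?p) \<otimes> s \<otimes> inv (g \<otimes> ?p) = g \<otimes> ((s \<otimes> t) [^] (2 * j) \<otimes> s) \<otimes> inv g"
    proof -
      have "(g \<otimes> ?p) \<otimes> s \<otimes> inv (g \<otimes> ?p) = g \<otimes> (?p \<otimes> (s \<otimes> inv ?p)) \<otimes> inv g"
        using g cl by (simp add: inv_mult_group m_assoc)
      also have "\<dots> = g \<otimes> ((?p \<otimes> ?p) \<otimes> s) \<otimes> inv g" unfolding sp using cl by (simp add: m_assoc)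
      finally show ?thesis using cl by (simp add: nat_pow_mult mult_2)
    qed
    have e2: "(g \<otimes> ?p \<otimes> s) \<otimes> t \<otimes> inv (g \<otimes> ?p \<otimes> s) = g \<otimes> ((s \<otimes> t) [^] Suc (2 * j) \<otimes> s) \<otimes> inv g"
    proof -
      have "(g \<otimes> ?p \<otimes> s) \<otimes> t \<otimes> inv (g \<otimes> ?p \<otimes> s) = g \<otimes> (?p \<otimes> (s \<otimes> (t \<otimes> (s \<otimes> inv ?p)))) \<otimes> inv g"
        using g cl st by (simp add: inv_mult_group m_assoc inv_S)
      also have "\<dots> = g \<otimes> (?p \<otimes> ((s \<otimes> s) \<otimes> (?p \<otimes> (s \<otimes> (t \<otimes> s))))) \<otimes> inv g"
        unfolding sp comm using cl by (simp only: m_assoc m_closed)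
      also have "\<dots> = g \<otimes> ((?p \<otimes> ?p) \<otimes> (s \<otimes> t) \<otimes> s) \<otimes> inv g" using cl st by (simp add: m_assoc)
      finally show ?thesis using cl by (simp add: nat_pow_mult mult_2)
    qed
    have "concat (replicate j [s, t]) \<in> lists (carrier G)"
      using concat_replicate_lists cl(1,2) .
    then have "crossings ?f g (concat (replicate (Suc j) [s, t])) =
        (\<Sum>i<2 * j. c i) + (of_bool ((g \<otimes> ?p) \<otimes> s \<otimes> inv (g \<otimes> ?p) = x) +
        of_bool ((g \<otimes> ?p \<otimes> s) \<otimes> t \<otimes> inv (g \<otimes> ?p \<otimes> s) = x))"
      unfolding concat_replicate_Suc using Suc g ev_pow[OF st]
      by (simp add: crossings_append del: in_lists_conv_set)
    then show ?case unfolding e1 e2 by (simp add: c_def)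
  qed simp
  have "(s \<otimes> t) [^] k = \<one>" using ev_relator[OF r] ev_pow[OF st] r' by simp
  \<comment> \<open>As \<open>(s \<otimes> t) [^] k\<close> is trivial, the second half of the
    \<open>2 * k\<close> positions repeats the first.\<close>
  then have "c (k + i) = c i" for i using cl nat_pow_mult[of "s \<otimes> t" k i] by (simp add: c_def)
  then have "(\<Sum>i<k + n. c i) = (\<Sum>i<k. c i) + (\<Sum>i<n. c i)" for n by (induction n) auto
  then show "even (crossings ?f g r)" unfolding r' cnt mult_2 by simp
qed (use that in blast)

section \<open>Visual subgroups and their intersections\<close>

lemma subgroup_parabolic: "I \<subseteq> S \<Longrightarrow> subgroup (parabolic I) G"
proof
  assume I: "I \<subseteq> S"
  have IS: "lists I \<subseteq> lists S" using I by (rule lists_mono)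
  show "parabolic I \<subseteq> carrier G" unfolding parabolic_def using IS ev_S_closed by blast
  show "\<one> \<in> parabolic I" unfolding parabolic_def by (rule image_eqI[of _ _ "[]"]) auto
  fix x assume "x \<in> parabolic I"
  then obtain u where u: "u \<in> lists I" "x = ev u" by (auto simp: parabolic_def)
  have "ev (rev u) = inv x" using ev_rev u IS by blast
  then show "inv x \<in> parabolic I" using u unfolding parabolic_def by (intro image_eqI[of _ _ "rev u"]) auto
  fix y assume "y \<in> parabolic I"
  then obtain v where v: "v \<in> lists I" "y = ev v" by (auto simp: parabolic_def)
  have "ev (u @ v) = x \<otimes> y" using u v IS ev_append word_closed by blast
  then show "x \<otimes> y \<in> parabolic I"
    using u v unfolding parabolic_def by (intro image_eqI[of _ _ "u @ v"]) auto
qed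

lemma parabolic_gen: "s \<in> I \<Longrightarrow> I \<subseteq> S \<Longrightarrow> s \<in> parabolic I"
  unfolding parabolic_def by (rule image_eqI[of _ _ "[s]"]) auto

lemma parabolic_mono: "I \<subseteq> J \<Longrightarrow> parabolic I \<subseteq> parabolic J"
  unfolding parabolic_def using lists_mono by blast

lemma parabolic_S: "parabolic S = carrier G"
proof
  show "parabolic S \<subseteq> carrier G" unfolding parabolic_def using ev_S_closed by blast
  show "carrier G \<subseteq> parabolic S"
    using system unfolding coxeter_system_def parabolic_def by (metis image_eqI subsetI)
qed

lemma parabolic_induct [consumes 2, case_names one step]:
  assumes "g \<in> parabolic I" "I \<subseteq> S" and "Q \<one>"
    and step: "\<And>g s. g \<in> parabolic I \<Longrightarrow> Q g \<Longrightarrow> s \<in> I \<Longrightarrow> Q (g \<otimes> s)"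
  shows "Q g"
proof -
  obtain w where w: "w \<in> lists I" "g = ev w" using assms by (auto simp: parabolic_def)
  have "Q (ev w)" using w(1)
  proof (induction w rule: rev_induct)
    case (snoc s w)
    then have "w \<in> lists I" "s \<in> I" by auto
    moreover have "ev (w @ [s]) = ev w \<otimes> ev [s]"
      by (intro ev_append word_closed) (use snoc \<open>I \<subseteq> S\<close> in auto)
    moreover have "s \<in> carrier G" using \<open>s \<in> I\<close> \<open>I \<subseteq> S\<close> by auto
    ultimately show ?case using snoc step[of "ev w" s] by (simp add: parabolic_def)
  qed (use assms in simp)
  then show ?thesis using w by simp
qed

text \<open>If the parity is odd, \<open>x\<close> is read at some letter of a word over
  \<open>I\<close>, and there it is a product of elements of \<open>parabolic I\<close>.\<close>

lemma reflection_of_word: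
  assumes "\<not> F \<one>" and F: "\<And>g s. g \<in> carrier G \<Longrightarrow> s \<in> S \<Longrightarrow> F (g \<otimes> s) = (F g \<noteq> (g \<otimes> s \<otimes> inv g = x))"
    and "I \<subseteq> S" "g \<in> parabolic I" "F g"
  shows "x \<in> parabolic I"
  using assms(4,3,5)
proof (induction rule: parabolic_induct)
  case (step g s)
  interpret I: subgroup "parabolic I" G using subgroup_parabolic[OF \<open>I \<subseteq> S\<close>] .
  have "s \<in> parabolic I" using step parabolic_gen \<open>I \<subseteq> S\<close> by blast
  then show ?case using step F[of g s] \<open>I \<subseteq> S\<close> by auto
qed (use assms in simp)

text \<open>The reflection \<open>r\<close>, read at the first letter, is not read again: a second
  occurrence would allow both letters to be deleted, against minimality. So its parity is
  odd.\<close>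

lemma first_reflection:
  assumes F1: "\<not> F \<one>" and F: "\<And>g s. g \<in> carrier G \<Longrightarrow> s \<in> S \<Longrightarrow> F (g \<otimes> s) = (F g \<noteq> (g \<otimes> s \<otimes> inv g = r))"
    and I: "I \<subseteq> S" and w: "r # w \<in> lists I"
    and min: "\<And>u. u \<in> lists I \<Longrightarrow> ev u = ev (r # w) \<Longrightarrow> length (r # w) \<le> length u"
  shows "F (ev (r # w))"
proof -
  have r: "r \<in> S" using w I by auto
  have "F (ev (r # p))" if "w = p @ q" for p q
    using that
  proof (induction p arbitrary: q rule: rev_induct)
    case Nil
    then show ?case using F[of \<one> r] F1 r by simp
  next
    case (snoc u p)
    have IH: "F (ev (r # p))" using snoc.IH[of "u # q"] snoc.prems by simp
    have pq: "p \<in> lists I" "u \<in> I" "q \<in> lists I" using w snoc.prems by auto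
    have S: "p \<in> lists S" "u \<in> S" "q \<in> lists S" using pq I by auto
    then have c: "ev p \<in> carrier G" "u \<in> carrier G" "ev q \<in> carrier G" "r \<in> carrier G" using r by auto
    have evw: "ev (r # w) = (ev (r # p) \<otimes> u) \<otimes> ev q"
      using snoc.prems S c word_closed by (simp add: ev_append m_assoc)
    have "ev (r # p) \<otimes> u \<otimes> inv (ev (r # p)) \<noteq> r"
    proof
      assume eq: "ev (r # p) \<otimes> u \<otimes> inv (ev (r # p)) = r"
      have "ev (r # p) \<otimes> u = (ev (r # p) \<otimes> u \<otimes> inv (ev (r # p))) \<otimes> ev (r # p)"
        using c by (simp add: m_assoc inv_mult_group inv_mult_cancel)
      also have "\<dots> = r \<otimes> (r \<otimes> ev p)" unfolding eq by simp
      also have "\<dots> = ev p" using c r by (simp add: m_assoc[symmetric])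
      finally have "ev (r # w) = ev (p @ q)" using evw S word_closed by (simp add: ev_append)
      then show False using min[of "p @ q"] pq snoc.prems by simp
    qed
    moreover have "ev (r # p @ [u]) = ev (r # p) \<otimes> u"
      using S c word_closed by (simp add: ev_append m_assoc)
    ultimately show ?case using F[of "ev (r # p)" u] IH S c by simp
  qed
  from this[of w "[]"] show ?thesis by simp
qed

lemma shortest_word:
  assumes "g \<in> parabolic I"
  obtains w where "w \<in> lists I" "ev w = g" "\<And>u. u \<in> lists I \<Longrightarrow> ev u = g \<Longrightarrow> length w \<le> length u"
proof -
  obtain w where "w \<in> lists I \<and> ev w = g" using assms by (auto simp: parabolic_def)
  from ex_has_least_nat[of "\<lambda>w. w \<in> lists I \<and> ev w = g", OF this, of length]
  show thesis using that by blast
qed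

text \<open>Let \<open>r\<close> be the first letter of a shortest word over \<open>I\<close> for
  \<open>s\<close>. Its parity at \<open>s\<close> is odd, but the one-letter word \<open>s\<close>
  reads only the reflection \<open>s\<close>; so \<open>s = r\<close>.\<close>

lemma S_Int_parabolic:
  assumes s: "s \<in> S" "s \<in> parabolic I" and I: "I \<subseteq> S" shows "s \<in> I"
proof -
  obtain w where w: "w \<in> lists I" "ev w = s" "\<And>u. u \<in> lists I \<Longrightarrow> ev u = s \<Longrightarrow> length w \<le> length u"
    using shortest_word[OF s(2)] by blast
  then obtain r v where rv: "w = r # v" using S_neq_one[OF s(1)] by (cases w) auto
  obtain F where F: "\<not> F \<one>" "\<And>g s. g \<in> carrier G \<Longrightarrow> s \<in> S \<Longrightarrow> F (g \<otimes> s) = (F g \<noteq> (g \<otimes> s \<otimes> inv g = r))"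
    using reflection_parity[of r] by blast
  have "F (ev (r # v))" by (rule first_reflection[OF F I]) (use w rv in auto)
  then have "F (\<one> \<otimes> s)" using w rv s by simp
  then have "s = r" using F(1) F(2)[of \<one> s] s by simp
  then show ?thesis using w rv by simp
qed

text \<open>The first letter \<open>r\<close> of a shortest word over \<open>I\<close> is a
  reflection of odd parity at an element of \<open>parabolic J\<close>. So \<open>r\<close> is in
  \<open>parabolic J\<close>, hence in \<open>J\<close>, and can be split off.\<close>

lemma parabolic_Int:
  assumes I: "I \<subseteq> S" and J: "J \<subseteq> S"
  shows "parabolic I \<inter> parabolic J = parabolic (I \<inter> J)"
proof
  show "parabolic (I \<inter> J) \<subseteq> parabolic I \<inter> parabolic J" using parabolic_mono by simp
  interpret J: subgroup "parabolic J" G using subgroup_parabolic[OF J] .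
  have IJ: "I \<inter> J \<subseteq> S" using I by blast
  interpret IJ: subgroup "parabolic (I \<inter> J)" G using subgroup_parabolic[OF IJ] .
  have "ev w \<in> parabolic (I \<inter> J)" if "w \<in> lists I" "ev w \<in> parabolic J" for w
    using that
  proof (induction "length w" arbitrary: w rule: less_induct)
    case less
    show ?case
    proof (cases "\<exists>u. u \<in> lists I \<and> ev u = ev w \<and> length u < length w")
      case True
      then obtain u where "u \<in> lists I" "ev u = ev w" "length u < length w" by blast
      then show ?thesis using less.hyps[of u] less.prems by simp
    next
      case False
      show ?thesis
      proof (cases w)
        case Nil then show ?thesis by simp
      next
        case (Cons r v)
        obtain F where F: "\<not> F \<one>" "\<And>g s. g \<in> carrier G \<Longrightarrow> s \<in> S \<Longrightarrow> F (g \<otimes> s) = (F g \<noteq> (g \<otimes> s \<otimes> inv g = r))"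
          using reflection_parity[of r] by blast
        have rI: "r \<in> I" "v \<in> lists I" using less.prems Cons by auto
        then have rS: "r \<in> S" "v \<in> lists S" using I by auto
        have "F (ev (r # v))"
        proof (rule first_reflection[OF F I])
          show "r # v \<in> lists I" using rI by simp
          fix u assume "u \<in> lists I" "ev u = ev (r # v)"
          then show "length (r # v) \<le> length u" using False Cons by (meson not_le)
        qed
        then have "r \<in> parabolic J"
          using reflection_of_word[OF F J less.prems(2)] Cons by simp
        then have "r \<in> J" using S_Int_parabolic[OF rS(1) _ J] by blast
        have "ev v = r \<otimes> ev w" using Cons rS by (simp add: m_assoc[symmetric])
        then have "ev v \<in> parabolic J" using \<open>r \<in> parabolic J\<close> less.prems by simp
        then have "ev v \<in> parabolic (I \<inter> J)" using less.hyps[of v] Cons rI by simp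
        moreover have "r \<in> parabolic (I \<inter> J)" using parabolic_gen[OF _ IJ] rI \<open>r \<in> J\<close> by blast
        ultimately show ?thesis using Cons by simp
      qed
    qed
  qed
  then show "parabolic I \<inter> parabolic J \<subseteq> parabolic (I \<inter> J)" unfolding parabolic_def[of I] by blast
qed

text \<open>How membership in \<open>P\<close> has to change along an edge of the Cayley graph is prescribed by a
  cochain that vanishes on all relators, so no normal form theorem for amalgams is needed.\<close>
lemma amalgam_half:
  assumes AB: "A \<union> B = S" and inf: "\<And>a b. a \<in> A - B \<Longrightarrow> b \<in> B - A \<Longrightarrow> m a b = \<infinity>"
  obtains P where "\<one> \<in> P" "\<And>g a. g \<in> carrier G \<Longrightarrow> a \<in> A \<Longrightarrow> g \<otimes> a \<in> P \<longleftrightarrow> g \<in> P"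
    "\<And>g b. g \<in> carrier G \<Longrightarrow> b \<in> B \<Longrightarrow>
       g \<otimes> b \<in> P - parabolic (A \<inter> B) \<longleftrightarrow> g \<in> P - parabolic (A \<inter> B)"
proof -
  let ?C = "parabolic (A \<inter> B)"
  have ABS: "A \<inter> B \<subseteq> S" "A \<subseteq> S" "B \<subseteq> S" using AB by auto
  interpret C: subgroup ?C G using subgroup_parabolic[OF ABS(1)] .
  \<comment> \<open>The side changes where a letter of \<open>B\<close> enters or leaves
    \<open>?C\<close>. Along words over \<open>B\<close> this is the coboundary of the indicator of
    \<open>?C\<close>; on letters of \<open>A\<close> it vanishes, because those that are also in
    \<open>B\<close> preserve \<open>?C\<close>.\<close>
  let ?f = "\<lambda>g s. s \<in> B \<and> (g \<in> ?C) \<noteq> (g \<otimes> s \<in> ?C)"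
  have C_iff: "g \<otimes> s \<in> ?C \<longleftrightarrow> g \<in> ?C" if "g \<in> carrier G" "s \<in> ?C" for g s
  proof
    assume "g \<otimes> s \<in> ?C"
    then have "(g \<otimes> s) \<otimes> inv s \<in> ?C" using that by blast
    then show "g \<in> ?C" using that by (simp add: m_assoc)
  qed (use that in blast)
  have fA: "\<not> ?f g s" if "g \<in> carrier G" "s \<in> A" for g s
    using C_iff[OF that(1)] parabolic_gen[OF _ ABS(1)] that by blast
  have wA: "crossings ?f g w = 0" if "g \<in> carrier G" "w \<in> lists A" for g w
    using that
  proof (induction w arbitrary: g)
    case (Cons s w)
    then have "s \<in> carrier G" using ABS by auto
    then show ?case using Cons fA[of g s] by simp
  qed simp
  have wB: "even (crossings ?f g w) \<longleftrightarrow> (g \<in> ?C \<longleftrightarrow> g \<otimes> ev w \<in> ?C)" if "g \<in> carrier G" "w \<in> lists B" for g w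
    using that
  proof (induction w arbitrary: g)
    case (Cons s w)
    then have "s \<in> carrier G" "s \<in> B" "w \<in> lists S" using ABS by auto
    then show ?case using Cons by (auto simp: m_assoc)
  qed simp
  have "even (crossings ?f g r)" if r: "r \<in> coxeter_relators S m" and g: "g \<in> carrier G" for r g
  proof -
    obtain s t k where st: "s \<in> S" "t \<in> S" "m s t = enat k" "r = concat (replicate k [s, t])"
      using r unfolding coxeter_relators_def by blast
    have "m t s = enat k" using st system by (simp add: coxeter_system_def coxeter_matrix_def)
    \<comment> \<open>A relator with letters from both \<open>A - B\<close> and \<open>B - A\<close>
      would need a finite value of \<open>m\<close>, against \<open>inf\<close>.\<close>
    then have "(s \<in> A \<and> t \<in> A) \<or> (s \<in> B \<and> t \<in> B)" using inf[of s t] inf[of t s] st AB by auto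
    then show ?thesis
    proof
      assume "s \<in> A \<and> t \<in> A"
      then have "r \<in> lists A" using st(4) concat_replicate_lists by metis
      then show ?thesis using wA g by simp
    next
      assume "s \<in> B \<and> t \<in> B"
      then have "r \<in> lists B" using st(4) concat_replicate_lists by metis
      then show ?thesis using wB[OF g] ev_relator[OF r] g by simp
    qed
  qed
  then obtain F where F1: "\<not> F \<one>" and F: "\<And>g s. g \<in> carrier G \<Longrightarrow> s \<in> S \<Longrightarrow> F (g \<otimes> s) = (F g \<noteq> ?f g s)"
    using potential[of ?f] by blast
  have FA: "F (g \<otimes> a) = F g" if "g \<in> carrier G" "a \<in> A" for g a
    using F[of g a] fA[of g a] that ABS by blast
  have FC: "\<not> F g" if "g \<in> ?C" for g
    using that ABS(1)
  proof (induction rule: parabolic_induct)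
    case (step g s)
    then show ?case using FA[of g s] by simp
  qed (use F1 in simp)
  show thesis
  proof (rule that[of "{g \<in> carrier G. \<not> F g}"])
    show "\<one> \<in> {g \<in> carrier G. \<not> F g}" using F1 by simp
    show "g \<otimes> a \<in> {g \<in> carrier G. \<not> F g} \<longleftrightarrow> g \<in> {g \<in> carrier G. \<not> F g}"
      if "g \<in> carrier G" "a \<in> A" for g a using FA[OF that] that ABS by auto
    show "g \<otimes> b \<in> {g \<in> carrier G. \<not> F g} - ?C \<longleftrightarrow> g \<in> {g \<in> carrier G. \<not> F g} - ?C"
      if g: "g \<in> carrier G" "b \<in> B" for g b
    proof -
      have "b \<in> S" using g ABS by blast
      then show ?thesis using F[of g b] FC[of g] FC[of "g \<otimes> b"] g by auto
    qed
  qed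
qed

text \<open>\<open>P\<close> is taken from the splitting of the whole group. It serves for
  \<open>parabolic L\<close> as well, because this subgroup meets
  \<open>parabolic (A \<inter> B)\<close> in
  \<open>parabolic (L \<inter> (A \<inter> B))\<close>.\<close>

lemma amalgam_parabolic:
  assumes AB: "A \<union> B = S" and inf: "\<And>a b. a \<in> A - B \<Longrightarrow> b \<in> B - A \<Longrightarrow> m a b = \<infinity>"
    and L: "L \<subseteq> S"
  obtains P where "amalgam G (parabolic L) (parabolic (L \<inter> A)) (parabolic (L \<inter> B)) (parabolic (L \<inter> (A \<inter> B))) P"
proof -
  obtain P where P1: "\<one> \<in> P" and PA: "\<And>g a. g \<in> carrier G \<Longrightarrow> a \<in> A \<Longrightarrow> g \<otimes> a \<in> P \<longleftrightarrow> g \<in> P"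
    and PB: "\<And>g b. g \<in> carrier G \<Longrightarrow> b \<in> B \<Longrightarrow>
       g \<otimes> b \<in> P - parabolic (A \<inter> B) \<longleftrightarrow> g \<in> P - parabolic (A \<inter> B)"
    using amalgam_half[OF AB inf] by blast
  have sub: "L \<inter> A \<subseteq> S" "L \<inter> B \<subseteq> S" "A \<inter> B \<subseteq> S" using L AB by auto
  interpret L: subgroup "parabolic L" G using subgroup_parabolic[OF L] .
  have LC: "parabolic (L \<inter> (A \<inter> B)) = parabolic L \<inter> parabolic (A \<inter> B)"
    using parabolic_Int[OF L sub(3)] by simp
  have pA: "a \<in> carrier G" if "a \<in> parabolic (L \<inter> A)" for a
    using that subgroup.mem_carrier[OF subgroup_parabolic[OF sub(1)]] by blast
  have pB: "a \<in> carrier G" if "a \<in> parabolic (L \<inter> B)" for a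
    using that subgroup.mem_carrier[OF subgroup_parabolic[OF sub(2)]] by blast
  have "amalgam G (parabolic L) (parabolic (L \<inter> A)) (parabolic (L \<inter> B)) (parabolic (L \<inter> (A \<inter> B))) P"
  proof (intro amalgam.intro amalgam_axioms.intro group_axioms)
    show "subgroup (parabolic L) G" "subgroup (parabolic (L \<inter> A)) G" "subgroup (parabolic (L \<inter> B)) G"
      by (intro subgroup_parabolic L sub)+
    show "parabolic (L \<inter> A) \<subseteq> parabolic L" "parabolic (L \<inter> B) \<subseteq> parabolic L"
      "parabolic (L \<inter> (A \<inter> B)) \<subseteq> parabolic (L \<inter> A)" "parabolic (L \<inter> (A \<inter> B)) \<subseteq> parabolic (L \<inter> B)"
      by (rule parabolic_mono; blast)+
    show "\<one> \<in> parabolic (L \<inter> (A \<inter> B))" "\<one> \<in> P"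
      using P1 subgroup.one_closed[OF subgroup_parabolic[of "L \<inter> (A \<inter> B)"]] L by auto
    show "g \<otimes> a \<in> P \<longleftrightarrow> g \<in> P" if g: "g \<in> parabolic L" and a: "a \<in> parabolic (L \<inter> A)" for g a
      using a sub(1)
    proof (induction rule: parabolic_induct)
      case (step h s)
      then have "s \<in> S" "s \<in> A" using AB by auto
      then show ?case using step g PA[of "g \<otimes> h" s] pA[of h] by (simp add: m_assoc)
    qed (use g in simp)
    show "g \<otimes> b \<in> P - parabolic (L \<inter> (A \<inter> B)) \<longleftrightarrow> g \<in> P - parabolic (L \<inter> (A \<inter> B))"
      if g: "g \<in> parabolic L" and b: "b \<in> parabolic (L \<inter> B)" for g b
    proof -
      have "g \<otimes> b \<in> P - parabolic (A \<inter> B) \<longleftrightarrow> g \<in> P - parabolic (A \<inter> B)"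
        using b sub(2)
      proof (induction rule: parabolic_induct)
        case (step h s)
        then have "s \<in> S" "s \<in> B" using AB by auto
        then show ?case using step g PB[of "g \<otimes> h" s] pB[of h] by (simp add: m_assoc)
      qed (use g in simp)
      moreover have "b \<in> parabolic L" using b parabolic_mono[of "L \<inter> B" L] by blast
      then have "g \<otimes> b \<in> parabolic L" using g by blast
      ultimately show ?thesis using g unfolding LC by blast
    qed
    show "parabolic L \<subseteq> Q" if Q1: "\<one> \<in> Q"
      and Q: "\<And>g a. g \<in> Q \<Longrightarrow> g \<in> parabolic L \<Longrightarrow> a \<in> parabolic (L \<inter> A) \<union> parabolic (L \<inter> B) \<Longrightarrow> g \<otimes> a \<in> Q" for Q
    proof
      fix g assume "g \<in> parabolic L"
      then show "g \<in> Q" using L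
      proof (induction rule: parabolic_induct)
        case (step g s)
        then have "s \<in> parabolic (L \<inter> A) \<union> parabolic (L \<inter> B)"
          using parabolic_gen[of s "L \<inter> A"] parabolic_gen[of s "L \<inter> B"] sub L AB by blast
        then show ?case using Q step by blast
      qed (rule Q1)
    qed
  qed
  then show thesis using that by blast
qed

section \<open>From a cycle of involutions to a clique, and the contradiction\<close>

lemma pdiagram_sym: "pdiagram_edge S m s t \<Longrightarrow> pdiagram_edge S m t s"
  using system by (auto simp: pdiagram_edge_def coxeter_system_def coxeter_matrix_def)

text \<open>The sequence \<open>t\<close> consists of arbitrary involutions, not of generators,
  because the induction on \<open>card L\<close> replaces it by a conjugate lying in a smaller
  visual subgroup. The conjugating elements accumulate in \<open>g\<close>.\<close>

lemma cycle_meets_clique: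
  fixes t :: "nat \<Rightarrow> 'a"
  assumes fin: "finite S" and chordal: "chordal_coxeter S m" and n: "4 \<le> n"
    and L: "L \<subseteq> S" and tL: "\<And>k. t k \<in> parabolic L" and sq: "\<And>k. t k \<otimes> t k = \<one>"
    and per: "\<And>k. t (k + n) = t k"
    and tor: "\<And>k. \<exists>r::nat. r > 0 \<and> (t k \<otimes> t (Suc k)) [^] r = \<one>"
  shows "\<exists>k l g D. Suc k < l \<and> Suc l < k + n \<and> g \<in> carrier G \<and> D \<subseteq> S \<and>
    (\<forall>u\<in>D. \<forall>v\<in>D. m u v \<noteq> \<infinity>) \<and>
    inv g \<otimes> t k \<otimes> g \<in> parabolic D \<and> inv g \<otimes> t l \<otimes> g \<in> parabolic D"
  using L tL sq per tor
proof (induction "card L" arbitrary: L t rule: less_induct)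
  case less
  let ?E = "pdiagram_edge S m"
  have mE: "m u v \<noteq> \<infinity>" if "u \<in> S" "v \<in> S" "u = v \<or> ?E u v" for u v
    using that system by (auto simp: pdiagram_edge_def coxeter_system_def coxeter_matrix_def one_enat_def)
  have subL: "subgroup (parabolic L) G" using subgroup_parabolic less.prems(1) by blast
  have tc: "t k \<in> carrier G" for k using subgroup.mem_carrier[OF subL less.prems(2)] .
  show ?case
  proof (cases "\<forall>u\<in>L. \<forall>v\<in>L. u = v \<or> ?E u v")
    case True
    then have "\<forall>u\<in>L. \<forall>v\<in>L. m u v \<noteq> \<infinity>" using mE less.prems(1) by blast
    moreover have "inv \<one> \<otimes> t k \<otimes> \<one> \<in> parabolic L" for k using less.prems(2)[of k] tc[of k] by simp
    \<comment> \<open>Positions 0 and 2 serve as non-neighbours, as \<open>n\<close> is at least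
      4.\<close>
    moreover have "Suc 0 < 2" "Suc 2 < 0 + n" using n by auto
    ultimately show ?thesis using less.prems(1) one_closed by blast
  next
    case False
    then obtain a b where ab: "a \<in> L" "b \<in> L" "a \<noteq> b" "\<not> ?E a b" by blast
    have chord: "chordal_graph S ?E" using chordal by (simp add: chordal_coxeter_def)
    have ES: "u \<in> S \<and> v \<in> S" if "?E u v" for u v using that by (simp add: pdiagram_edge_def)
    \<comment> \<open>The separator is taken in all of \<open>S\<close>. As \<open>a\<close> and
      \<open>b\<close> are in \<open>L\<close>, both \<open>L \<inter> A\<close> and
      \<open>L \<inter> B\<close> are proper subsets of \<open>L\<close>.\<close>
    obtain A B where AB: "A \<union> B = S" and a: "a \<in> A - B" and b: "b \<in> B - A"
      and sep: "\<And>u v. u \<in> A - B \<Longrightarrow> v \<in> B - A \<Longrightarrow> \<not> ?E u v"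
      and clique: "\<And>u v. u \<in> A \<inter> B \<Longrightarrow> v \<in> A \<inter> B \<Longrightarrow> u \<noteq> v \<Longrightarrow> ?E u v"
      using clique_separation[OF fin chord pdiagram_sym ES _ _ ab(3,4)] ab less.prems(1) by blast
    have inf: "m u v = \<infinity>" if "u \<in> A - B" "v \<in> B - A" for u v
      using sep[OF that] that AB by (auto simp: pdiagram_edge_def)
    obtain P where P: "amalgam G (parabolic L) (parabolic (L \<inter> A)) (parabolic (L \<inter> B)) (parabolic (L \<inter> (A \<inter> B))) P"
      using amalgam_parabolic[OF AB inf less.prems(1)] by blast
    have "n > 0" using n by simp
    from amalgam.cycle_conjugate[OF P this less.prems(2-5)]
    consider (conj) H g where "H \<in> {parabolic (L \<inter> A), parabolic (L \<inter> B)}" "g \<in> parabolic L"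
        "\<And>k. inv g \<otimes> t k \<otimes> g \<in> H"
      | (edge) k l g where "Suc k < l" "Suc l < k + n" "g \<in> parabolic L"
        "inv g \<otimes> t k \<otimes> g \<in> parabolic (L \<inter> A) \<inter> parabolic (L \<inter> B)"
        "inv g \<otimes> t l \<otimes> g \<in> parabolic (L \<inter> A) \<inter> parabolic (L \<inter> B)"
      by blast
    then show ?thesis
    proof cases
      case conj
      then obtain M where M: "M = L \<inter> A \<or> M = L \<inter> B" "H = parabolic M" by blast
      have gc: "g \<in> carrier G" using subgroup.mem_carrier[OF subL conj(2)] .
      have "M \<subset> L" using M a b ab by blast
      moreover have "finite L" using less.prems(1) fin finite_subset by blast
      ultimately have card: "card M < card L" by (rule psubset_card_mono[rotated])
      let ?u = "\<lambda>k. inv g \<otimes> t k \<otimes> g"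
      have "\<exists>k l h D. Suc k < l \<and> Suc l < k + n \<and> h \<in> carrier G \<and> D \<subseteq> S \<and>
        (\<forall>u\<in>D. \<forall>v\<in>D. m u v \<noteq> \<infinity>) \<and>
        inv h \<otimes> ?u k \<otimes> h \<in> parabolic D \<and> inv h \<otimes> ?u l \<otimes> h \<in> parabolic D"
      proof (rule less.hyps[OF card])
        show "M \<subseteq> S" using \<open>M \<subset> L\<close> less.prems(1) by blast
        show "?u k \<in> parabolic M" for k using conj M by blast
        show "?u k \<otimes> ?u k = \<one>" for k
          using conjugate_mult[OF gc tc tc] less.prems(3) gc by simp
        show "?u (k + n) = ?u k" for k using less.prems(4) by simp
        fix k
        obtain r :: nat where r: "r > 0" "(t k \<otimes> t (Suc k)) [^] r = \<one>" using less.prems(5) by blast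
        then have "(?u k \<otimes> ?u (Suc k)) [^] r = \<one>"
          using conjugate_mult[OF gc tc tc] conjugate_pow[OF gc m_closed[OF tc tc]] gc by simp
        then show "\<exists>r::nat. r > 0 \<and> (?u k \<otimes> ?u (Suc k)) [^] r = \<one>" using r by blast
      qed
      then obtain k l h D where *: "Suc k < l" "Suc l < k + n" "h \<in> carrier G" "D \<subseteq> S"
        "\<forall>u\<in>D. \<forall>v\<in>D. m u v \<noteq> \<infinity>"
        "inv h \<otimes> ?u k \<otimes> h \<in> parabolic D" "inv h \<otimes> ?u l \<otimes> h \<in> parabolic D" by blast
      have "inv h \<otimes> ?u k \<otimes> h = inv (g \<otimes> h) \<otimes> t k \<otimes> (g \<otimes> h)" for k
        using gc tc[of k] *(3) by (simp add: inv_mult_group m_assoc)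
      then have "inv (g \<otimes> h) \<otimes> t k \<otimes> (g \<otimes> h) \<in> parabolic D" "inv (g \<otimes> h) \<otimes> t l \<otimes> (g \<otimes> h) \<in> parabolic D"
        using *(6,7) by simp_all
      moreover have "g \<otimes> h \<in> carrier G" using gc *(3) by simp
      ultimately show ?thesis using *(1,2,4,5) by blast
    next
      case edge
      let ?D = "(L \<inter> A) \<inter> (L \<inter> B)"
      have "parabolic (L \<inter> A) \<inter> parabolic (L \<inter> B) = parabolic ?D"
        using less.prems(1) by (intro parabolic_Int) auto
      moreover have "\<forall>u\<in>?D. \<forall>v\<in>?D. m u v \<noteq> \<infinity>"
        using clique mE less.prems(1) by blast
      moreover have "?D \<subseteq> S" using less.prems(1) by blast
      moreover have "g \<in> carrier G" using subgroup.mem_carrier[OF subL edge(3)] .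
      ultimately show ?thesis using edge(1,2,4,5) by blast
    qed
  qed
qed

text \<open>In the application \<open>D\<close> is a clique of the other generating set, visible
  here only as a set of involutions with products of finite order. Therefore the result is phrased
  with a subgroup \<open>H\<close> that contains a conjugate of \<open>D\<close>.\<close>

lemma no_conjugates_in_torsion_generated:
  assumes a: "a \<in> S" and b: "b \<in> S" and inf: "m a b = \<infinity>"
    and D: "finite D" "D \<subseteq> carrier G" and sq: "\<And>x. x \<in> D \<Longrightarrow> x \<otimes> x = \<one>"
    and tor: "\<And>x y. x \<in> D \<Longrightarrow> y \<in> D \<Longrightarrow> \<exists>n::nat. n > 0 \<and> (x \<otimes> y) [^] n = \<one>"
    and g: "g \<in> carrier G"
  shows "\<exists>H h. subgroup H G \<and> h \<in> carrier G \<and> (\<forall>x\<in>D. inv h \<otimes> x \<otimes> h \<in> H) \<and>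
    \<not> (inv (g \<otimes> h) \<otimes> a \<otimes> (g \<otimes> h) \<in> H \<and> inv (g \<otimes> h) \<otimes> b \<otimes> (g \<otimes> h) \<in> H)"
proof -
  have mba: "m b a = \<infinity>" using inf a b system by (simp add: coxeter_system_def coxeter_matrix_def)
  have "m a a = 1" using a system by (simp add: coxeter_system_def coxeter_matrix_def)
  then have ne: "a \<noteq> b" using inf by auto
  \<comment> \<open>The differences \<open>?A - ?B\<close> and \<open>?B - ?A\<close> are
    \<open>{a}\<close> and \<open>{b}\<close>, so \<open>inf\<close> is exactly the condition for a
    splitting.\<close>
  let ?A = "S - {b}" and ?B = "S - {a}"
  have sub: "?A \<subseteq> S" "?B \<subseteq> S" by auto
  obtain P where "amalgam G (parabolic S) (parabolic (S \<inter> ?A)) (parabolic (S \<inter> ?B)) (parabolic (S \<inter> (?A \<inter> ?B))) P"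
    by (rule amalgam_parabolic[of ?A ?B S]) (use ne inf in auto)
  then have P: "amalgam G (carrier G) (parabolic ?A) (parabolic ?B) (parabolic (S \<inter> (?A \<inter> ?B))) P"
    unfolding parabolic_S by (simp add: Int_absorb1)
  obtain H h where H: "H \<in> {parabolic ?A, parabolic ?B}" "h \<in> carrier G"
    "\<forall>x\<in>D. inv h \<otimes> x \<otimes> h \<in> H"
    using amalgam.fix_common_conjugate[OF P D sq tor] by blast
  have "a \<in> parabolic ?A" "b \<in> parabolic ?B" using a b ne by (auto intro!: parabolic_gen)
  moreover have "a \<notin> parabolic ?B" "b \<notin> parabolic ?A"
    using S_Int_parabolic[OF a _ sub(2)] S_Int_parabolic[OF b _ sub(1)] by auto
  ultimately have "a \<in> parabolic ?A - parabolic ?B" "b \<in> parabolic ?B - parabolic ?A" by simp_all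
  then have "\<not> (inv (g \<otimes> h) \<otimes> a \<otimes> (g \<otimes> h) \<in> H \<and> inv (g \<otimes> h) \<otimes> b \<otimes> (g \<otimes> h) \<in> H)"
    using amalgam.no_common_conjugate[OF P, of a b H "g \<otimes> h"] H g a b by simp
  moreover have "subgroup H G" using H(1) subgroup_parabolic[OF sub(1)] subgroup_parabolic[OF sub(2)] by auto
  ultimately show ?thesis using H by blast
qed

end

theorem theorem3p3:
  fixes G :: "('a, 'b) monoid_scheme"
    and S S' :: "'a set"
    and m m' :: "'a \<Rightarrow> 'a \<Rightarrow> enat"
  assumes "coxeter_system G S m"
    and "finite S"
    and "chordal_coxeter S m"
    and "coxeter_system G S' m'"
  shows "chordal_coxeter S' m'"
  unfolding chordal_coxeter_def chordal_graph_def
proof (intro allI impI, elim conjE, rule ccontr)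
  interpret c1: coxeter G S m using assms by unfold_locales
  interpret c2: coxeter G S' m' using assms by unfold_locales
  let ?E = "pdiagram_edge S' m'"
  fix vs assume vs: "set vs \<subseteq> S'" "graph_cycle ?E vs" "4 \<le> length vs" "\<not> has_chord ?E vs"
  define n where "n = length vs"
  have n: "4 \<le> n" "0 < n" using vs by (auto simp: n_def)
  \<comment> \<open>The cycle is unrolled periodically, so that cyclic neighbours become successive
    indices.\<close>
  define t where "t k = vs ! (k mod n)" for k
  have tS: "t k \<in> S'" for k using vs n by (auto simp: t_def n_def subset_iff)
  have edge: "?E (t k) (t (Suc k))" for k
  proof -
    have "?E (vs ! (k mod n)) (vs ! ((k mod n + 1) mod n))"
      using vs(2) n unfolding graph_cycle_def n_def by simp
    then show ?thesis by (simp add: t_def mod_Suc_eq)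
  qed
  obtain k l g D where kl: "Suc k < l" "Suc l < k + n" and g: "g \<in> carrier G" and D: "D \<subseteq> S"
    "\<forall>u\<in>D. \<forall>v\<in>D. m u v \<noteq> \<infinity>"
    and tD: "inv\<^bsub>G\<^esub> g \<otimes>\<^bsub>G\<^esub> t k \<otimes>\<^bsub>G\<^esub> g \<in> c1.parabolic D" "inv\<^bsub>G\<^esub> g \<otimes>\<^bsub>G\<^esub> t l \<otimes>\<^bsub>G\<^esub> g \<in> c1.parabolic D"
  proof -
    have "\<exists>k l g D. Suc k < l \<and> Suc l < k + n \<and> g \<in> carrier G \<and> D \<subseteq> S \<and>
      (\<forall>u\<in>D. \<forall>v\<in>D. m u v \<noteq> \<infinity>) \<and>
      inv\<^bsub>G\<^esub> g \<otimes>\<^bsub>G\<^esub> t k \<otimes>\<^bsub>G\<^esub> g \<in> c1.parabolic D \<and> inv\<^bsub>G\<^esub> g \<otimes>\<^bsub>G\<^esub> t l \<otimes>\<^bsub>G\<^esub> g \<in> c1.parabolic D"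
    proof (rule c1.cycle_meets_clique[OF assms(2,3) n(1) subset_refl])
      show "t k \<in> c1.parabolic S" for k using tS c1.parabolic_S by simp
      show "t k \<otimes>\<^bsub>G\<^esub> t k = \<one>\<^bsub>G\<^esub>" for k using tS by simp
      show "t (k + n) = t k" for k by (simp add: t_def)
      show "\<exists>r::nat. r > 0 \<and> (t k \<otimes>\<^bsub>G\<^esub> t (Suc k)) [^]\<^bsub>G\<^esub> r = \<one>\<^bsub>G\<^esub>" for k
        using c2.torsion[OF tS tS] edge by (simp add: pdiagram_edge_def)
    qed
    then show thesis using that by blast
  qed
  let ?i = "k mod n" and ?j = "l mod n"
  have mods: "p mod n \<noteq> q mod n" if "p < q" "q < p + n" for p q
  proof
    assume "p mod n = q mod n"
    then have "n dvd q - p" using that by (metis mod_eq_dvd_iff_nat less_imp_le)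
    then show False using that by (auto dest!: dvd_imp_le)
  qed
  \<comment> \<open>These are the index conditions in \<open>has_chord\<close>, so an edge between
    \<open>t k\<close> and \<open>t l\<close> would be a chord.\<close>
  have ne: "?i \<noteq> ?j" "?j \<noteq> (?i + 1) mod n" "?i \<noteq> (?j + 1) mod n"
    using mods[of k l] mods[of "Suc k" l] mods[of "Suc l" "k + n"] kl by (auto simp: mod_Suc_eq)
  have "\<not> ?E (t k) (t l)"
  proof
    assume "?E (t k) (t l)"
    moreover have "?i < n" "?j < n" using n by simp_all
    ultimately have "has_chord ?E vs" unfolding has_chord_def t_def n_def[symmetric] using ne by blast
    then show False using vs(4) by simp
  qed
  moreover have "t k \<noteq> t l"
    using vs(2) ne n unfolding graph_cycle_def t_def n_def by (simp add: nth_eq_iff_index_eq)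
  ultimately have inf: "m' (t k) (t l) = \<infinity>" using tS by (simp add: pdiagram_edge_def)
  have Dc: "finite D" "D \<subseteq> carrier G" using D(1) assms(2) finite_subset c1.S_carrier by auto
  obtain H h where H: "subgroup H G" "h \<in> carrier G" "\<forall>x\<in>D. inv\<^bsub>G\<^esub> h \<otimes>\<^bsub>G\<^esub> x \<otimes>\<^bsub>G\<^esub> h \<in> H"
    and no: "\<not> (inv\<^bsub>G\<^esub> (g \<otimes>\<^bsub>G\<^esub> h) \<otimes>\<^bsub>G\<^esub> t k \<otimes>\<^bsub>G\<^esub> (g \<otimes>\<^bsub>G\<^esub> h) \<in> H \<and> inv\<^bsub>G\<^esub> (g \<otimes>\<^bsub>G\<^esub> h) \<otimes>\<^bsub>G\<^esub> t l \<otimes>\<^bsub>G\<^esub> (g \<otimes>\<^bsub>G\<^esub> h) \<in> H)"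
  proof -
    have "\<exists>n::nat. n > 0 \<and> (x \<otimes>\<^bsub>G\<^esub> y) [^]\<^bsub>G\<^esub> n = \<one>\<^bsub>G\<^esub>" if "x \<in> D" "y \<in> D" for x y
      using c1.torsion[of x y] D that by blast
    moreover have "x \<otimes>\<^bsub>G\<^esub> x = \<one>\<^bsub>G\<^esub>" if "x \<in> D" for x using D that by auto
    ultimately show thesis
      using c2.no_conjugates_in_torsion_generated[OF tS tS inf Dc _ _ g] that by blast
  qed
  \<comment> \<open>Conjugation is a homomorphism, so the statement passes from the generators
    \<open>D\<close> to \<open>parabolic D\<close>. Conjugating by \<open>g\<close> and then by
    \<open>h\<close> takes both \<open>t k\<close> and \<open>t l\<close> into \<open>H\<close>,
    against \<open>no\<close>.\<close>
  have conj: "inv\<^bsub>G\<^esub> h \<otimes>\<^bsub>G\<^esub> y \<otimes>\<^bsub>G\<^esub> h \<in> H" if "y \<in> c1.parabolic D" for y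
    using that D(1)
  proof (induction rule: c1.parabolic_induct)
    case one
    then show ?case using H subgroup.one_closed by simp
  next
    case (step y s)
    have "y \<in> carrier G" using subgroup.mem_carrier[OF c1.subgroup_parabolic[OF D(1)] step(1)] .
    moreover have "s \<in> carrier G" using step Dc(2) by auto
    ultimately have "inv\<^bsub>G\<^esub> h \<otimes>\<^bsub>G\<^esub> (y \<otimes>\<^bsub>G\<^esub> s) \<otimes>\<^bsub>G\<^esub> h = (inv\<^bsub>G\<^esub> h \<otimes>\<^bsub>G\<^esub> y \<otimes>\<^bsub>G\<^esub> h) \<otimes>\<^bsub>G\<^esub> (inv\<^bsub>G\<^esub> h \<otimes>\<^bsub>G\<^esub> s \<otimes>\<^bsub>G\<^esub> h)"
      using c1.conjugate_mult[OF H(2)] by simp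
    then show ?case using step H subgroup.m_closed[OF H(1)] by simp
  qed
  have "inv\<^bsub>G\<^esub> h \<otimes>\<^bsub>G\<^esub> (inv\<^bsub>G\<^esub> g \<otimes>\<^bsub>G\<^esub> t i \<otimes>\<^bsub>G\<^esub> g) \<otimes>\<^bsub>G\<^esub> h = inv\<^bsub>G\<^esub> (g \<otimes>\<^bsub>G\<^esub> h) \<otimes>\<^bsub>G\<^esub> t i \<otimes>\<^bsub>G\<^esub> (g \<otimes>\<^bsub>G\<^esub> h)" for i
    using g H(2) c2.S_closed[OF tS[of i]] by (simp add: c1.inv_mult_group c1.m_assoc)
  then show False using no conj[OF tD(1)] conj[OF tD(2)] by simp
qed

end
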